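(* (a) Any full exact subcategory (that is, full subcategory closed under extensions, with the induced exact structure) of a profinitary abelian category is cofinitary. (b) Any profinitary exact category whose Grothendieck monoid is finitely generated is cofinitary.
   Context: All categories are essentially small; exact categories are in the sense of Quillen (abelian categories carry their standard exact structure). $\mathrm{Iso}\,\mathscr A$ is the set of isomorphism classes $[X]$ of objects, an abelian monoid under $[X]+[Y]=[X\oplus Y]$. $\underline{\mathrm{Ext}}^1_{\mathscr A}(A,B)$ is the set of all $[X]$ such that there is a short exact sequence $B\rightarrowtail X\twoheadrightarrow A$. The Grothendieck monoid $\Gamma_{\mathscr A}$ is the quotient of $\mathrm{Iso}\,\mathscr A$ by the congruence which is the transitive closure of: $[X]\equiv[Y]$ if $[X],[Y]\in\underline{\mathrm{Ext}}^1_{\mathscr A}(M,N)$ for some $M,N$; $|X|$ is the image of $X$ in $\Gamma_{\mathscr A}$ and $\mathrm{Iso}\,\mathscr A_\gamma=\{[X]:|X|=\gamma\}$. A Hom-finite exact category (all Hom sets finite) is profinitary if $\mathrm{Iso}\,\mathscr A_\gamma$ is finite for all $\gamma\in\Gamma_{\mathscr A}$, and cofinitary if for every $[X]$ the set of pairs $([A],[B])\in\mathrm{Iso}\,\mathscr A\times\mathrm{Iso}\,\mathscr A$ with $[X]\in\underline{\mathrm{Ext}}^1_{\mathscr A}(A,B)$ is finite. *)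

theory Defs
  imports "HOL-Algebra.Group"
begin

section \<open>Categories\<close>

text \<open>The objects of a category form a set in a type, so every category here is small. An
  essentially small category is represented by any small category equivalent to it.\<close>

record ('o, 'm) cat =
  obj :: "'o set"
  arr :: "'m set"
  src :: "'m \<Rightarrow> 'o"
  tgt :: "'m \<Rightarrow> 'o"
  ident :: "'o \<Rightarrow> 'm"
  comp :: "'m \<Rightarrow> 'm \<Rightarrow> 'm"  (infixl "\<cdot>\<index>" 70)

definition mor :: "('o, 'm, 'x) cat_scheme \<Rightarrow> 'o \<Rightarrow> 'o \<Rightarrow> 'm set" where
  "mor C X Y = {f \<in> arr C. src C f = X \<and> tgt C f = Y}"

locale category =
  fixes C :: "('o, 'm, 'x) cat_scheme" (structure)
  assumes src_obj: "f \<in> arr C \<Longrightarrow> src C f \<in> obj C"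
    and tgt_obj: "f \<in> arr C \<Longrightarrow> tgt C f \<in> obj C"
    and ident_mor: "X \<in> obj C \<Longrightarrow> ident C X \<in> mor C X X"
    and comp_mor: "\<lbrakk>f \<in> mor C X Y; g \<in> mor C Y Z\<rbrakk> \<Longrightarrow> g \<cdot> f \<in> mor C X Z"
    and comp_ident: "f \<in> mor C X Y \<Longrightarrow> f \<cdot> ident C X = f"
    and ident_comp: "f \<in> mor C X Y \<Longrightarrow> ident C Y \<cdot> f = f"
    and comp_assoc: "\<lbrakk>f \<in> mor C W X; g \<in> mor C X Y; h \<in> mor C Y Z\<rbrakk> \<Longrightarrow> (h \<cdot> g) \<cdot> f = h \<cdot> (g \<cdot> f)"

definition iso_mor :: "('o, 'm, 'x) cat_scheme \<Rightarrow> 'o \<Rightarrow> 'o \<Rightarrow> 'm set" where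
  "iso_mor C X Y = {f \<in> mor C X Y. \<exists>g \<in> mor C Y X. g \<cdot>\<^bsub>C\<^esub> f = ident C X \<and> f \<cdot>\<^bsub>C\<^esub> g = ident C Y}"

definition isomorphic :: "('o, 'm, 'x) cat_scheme \<Rightarrow> 'o \<Rightarrow> 'o \<Rightarrow> bool" where
  "isomorphic C X Y \<longleftrightarrow> iso_mor C X Y \<noteq> {}"

definition monic :: "('o, 'm, 'x) cat_scheme \<Rightarrow> 'm \<Rightarrow> bool" where
  "monic C f \<longleftrightarrow> f \<in> arr C \<and>
    (\<forall>W. \<forall>g \<in> mor C W (src C f). \<forall>h \<in> mor C W (src C f). f \<cdot>\<^bsub>C\<^esub> g = f \<cdot>\<^bsub>C\<^esub> h \<longrightarrow> g = h)"

definition epic :: "('o, 'm, 'x) cat_scheme \<Rightarrow> 'm \<Rightarrow> bool" where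
  "epic C f \<longleftrightarrow> f \<in> arr C \<and>
    (\<forall>W. \<forall>g \<in> mor C (tgt C f) W. \<forall>h \<in> mor C (tgt C f) W. g \<cdot>\<^bsub>C\<^esub> f = h \<cdot>\<^bsub>C\<^esub> f \<longrightarrow> g = h)"

definition zero_object :: "('o, 'm, 'x) cat_scheme \<Rightarrow> 'o \<Rightarrow> bool" where
  "zero_object C Z \<longleftrightarrow> Z \<in> obj C \<and>
    (\<forall>X \<in> obj C. (\<exists>!f. f \<in> mor C X Z) \<and> (\<exists>!f. f \<in> mor C Z X))"

text \<open>\<open>is_pushout C i f i' f'\<close>: the span \<open>Y \<leftarrow>i\<midarrow> X \<midarrow>f\<rightarrow> X'\<close> has pushout \<open>P\<close> with legs
  \<open>i' : X' \<rightarrow> P\<close> (opposite \<open>i\<close>) and \<open>f' : Y \<rightarrow> P\<close> (opposite \<open>f\<close>). Dually for \<open>is_pullback\<close>.\<close>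

definition is_pushout :: "('o, 'm, 'x) cat_scheme \<Rightarrow> 'm \<Rightarrow> 'm \<Rightarrow> 'm \<Rightarrow> 'm \<Rightarrow> bool" where
  "is_pushout C i f i' f' \<longleftrightarrow>
    (\<exists>X Y X' P. i \<in> mor C X Y \<and> f \<in> mor C X X' \<and> i' \<in> mor C X' P \<and> f' \<in> mor C Y P \<and>
      f' \<cdot>\<^bsub>C\<^esub> i = i' \<cdot>\<^bsub>C\<^esub> f \<and>
      (\<forall>Q. \<forall>u \<in> mor C Y Q. \<forall>v \<in> mor C X' Q. u \<cdot>\<^bsub>C\<^esub> i = v \<cdot>\<^bsub>C\<^esub> f \<longrightarrow>
        (\<exists>!w. w \<in> mor C P Q \<and> w \<cdot>\<^bsub>C\<^esub> f' = u \<and> w \<cdot>\<^bsub>C\<^esub> i' = v)))"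

definition is_pullback :: "('o, 'm, 'x) cat_scheme \<Rightarrow> 'm \<Rightarrow> 'm \<Rightarrow> 'm \<Rightarrow> 'm \<Rightarrow> bool" where
  "is_pullback C p f p' f' \<longleftrightarrow>
    (\<exists>Y Z Z' P. p \<in> mor C Y Z \<and> f \<in> mor C Z' Z \<and> p' \<in> mor C P Z' \<and> f' \<in> mor C P Y \<and>
      p \<cdot>\<^bsub>C\<^esub> f' = f \<cdot>\<^bsub>C\<^esub> p' \<and>
      (\<forall>Q. \<forall>u \<in> mor C Q Y. \<forall>v \<in> mor C Q Z'. p \<cdot>\<^bsub>C\<^esub> u = f \<cdot>\<^bsub>C\<^esub> v \<longrightarrow>
        (\<exists>!w. w \<in> mor C Q P \<and> f' \<cdot>\<^bsub>C\<^esub> w = u \<and> p' \<cdot>\<^bsub>C\<^esub> w = v)))"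

section \<open>Additive and abelian categories\<close>

record ('o, 'm) preadd_cat = "('o, 'm) cat" +
  msum :: "'m \<Rightarrow> 'm \<Rightarrow> 'm"  (infixl "\<boxplus>\<index>" 65)
  mzero :: "'o \<Rightarrow> 'o \<Rightarrow> 'm"

definition hom_group :: "('o, 'm, 'x) preadd_cat_scheme \<Rightarrow> 'o \<Rightarrow> 'o \<Rightarrow> 'm monoid" where
  "hom_group C X Y = \<lparr>carrier = mor C X Y, mult = msum C, one = mzero C X Y\<rparr>"

locale preadditive_category = category C
  for C :: "('o, 'm, 'x) preadd_cat_scheme" (structure) +
  assumes hom_comm_group: "\<lbrakk>X \<in> obj C; Y \<in> obj C\<rbrakk> \<Longrightarrow> comm_group (hom_group C X Y)"
    and comp_sum_left: "\<lbrakk>f \<in> mor C X Y; g \<in> mor C Y Z; h \<in> mor C Y Z\<rbrakk> \<Longrightarrow>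
      (g \<boxplus> h) \<cdot> f = (g \<cdot> f) \<boxplus> (h \<cdot> f)"
    and comp_sum_right: "\<lbrakk>f \<in> mor C X Y; g \<in> mor C X Y; h \<in> mor C Y Z\<rbrakk> \<Longrightarrow>
      h \<cdot> (f \<boxplus> g) = (h \<cdot> f) \<boxplus> (h \<cdot> g)"

text \<open>\<open>is_biproduct C X Y S i j p q\<close>: \<open>S = X \<oplus> Y\<close> with injections \<open>i : X \<rightarrow> S\<close>, \<open>j : Y \<rightarrow> S\<close> and
  projections \<open>p : S \<rightarrow> X\<close>, \<open>q : S \<rightarrow> Y\<close>.\<close>

definition is_biproduct ::
    "('o, 'm, 'x) preadd_cat_scheme \<Rightarrow> 'o \<Rightarrow> 'o \<Rightarrow> 'o \<Rightarrow> 'm \<Rightarrow> 'm \<Rightarrow> 'm \<Rightarrow> 'm \<Rightarrow> bool" where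
  "is_biproduct C X Y S i j p q \<longleftrightarrow>
    i \<in> mor C X S \<and> j \<in> mor C Y S \<and> p \<in> mor C S X \<and> q \<in> mor C S Y \<and>
    p \<cdot>\<^bsub>C\<^esub> i = ident C X \<and> q \<cdot>\<^bsub>C\<^esub> j = ident C Y \<and>
    p \<cdot>\<^bsub>C\<^esub> j = mzero C Y X \<and> q \<cdot>\<^bsub>C\<^esub> i = mzero C X Y \<and>
    (i \<cdot>\<^bsub>C\<^esub> p) \<boxplus>\<^bsub>C\<^esub> (j \<cdot>\<^bsub>C\<^esub> q) = ident C S"

locale additive_category = preadditive_category C
  for C :: "('o, 'm, 'x) preadd_cat_scheme" (structure) +
  assumes ex_zero_object: "\<exists>Z. zero_object C Z"
    and ex_biproduct: "\<lbrakk>X \<in> obj C; Y \<in> obj C\<rbrakk> \<Longrightarrow> \<exists>S i j p q. is_biproduct C X Y S i j p q"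

definition is_kernel :: "('o, 'm, 'x) preadd_cat_scheme \<Rightarrow> 'm \<Rightarrow> 'm \<Rightarrow> bool" where
  "is_kernel C p i \<longleftrightarrow>
    (\<exists>X Y Z. i \<in> mor C X Y \<and> p \<in> mor C Y Z \<and> p \<cdot>\<^bsub>C\<^esub> i = mzero C X Z \<and>
      (\<forall>W. \<forall>f \<in> mor C W Y. p \<cdot>\<^bsub>C\<^esub> f = mzero C W Z \<longrightarrow> (\<exists>!g. g \<in> mor C W X \<and> i \<cdot>\<^bsub>C\<^esub> g = f)))"

definition is_cokernel :: "('o, 'm, 'x) preadd_cat_scheme \<Rightarrow> 'm \<Rightarrow> 'm \<Rightarrow> bool" where
  "is_cokernel C i p \<longleftrightarrow>
    (\<exists>X Y Z. i \<in> mor C X Y \<and> p \<in> mor C Y Z \<and> p \<cdot>\<^bsub>C\<^esub> i = mzero C X Z \<and>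
      (\<forall>W. \<forall>f \<in> mor C Y W. f \<cdot>\<^bsub>C\<^esub> i = mzero C X W \<longrightarrow> (\<exists>!g. g \<in> mor C Z W \<and> g \<cdot>\<^bsub>C\<^esub> p = f)))"

locale abelian_category = additive_category C
  for C :: "('o, 'm, 'x) preadd_cat_scheme" (structure) +
  assumes ex_kernel: "f \<in> arr C \<Longrightarrow> \<exists>i. is_kernel C f i"
    and ex_cokernel: "f \<in> arr C \<Longrightarrow> \<exists>p. is_cokernel C f p"
    and monic_is_kernel: "monic C i \<Longrightarrow> \<exists>p. is_kernel C p i"
    and epic_is_cokernel: "epic C p \<Longrightarrow> \<exists>i. is_cokernel C i p"

section \<open>Exact categories\<close>

text \<open>An exact structure is a set \<open>E\<close> of pairs \<open>(i, p)\<close>, the distinguished short exact sequences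
  \<open>X \<rightarrowtail>i\<rightarrow> Y \<twoheadrightarrow>p\<rightarrow> Z\<close>.\<close>

definition kernel_cokernel_pairs :: "('o, 'm, 'x) preadd_cat_scheme \<Rightarrow> ('m \<times> 'm) set" where
  "kernel_cokernel_pairs C = {(i, p). is_kernel C p i \<and> is_cokernel C i p}"

definition inflation :: "('m \<times> 'm) set \<Rightarrow> 'm \<Rightarrow> bool" where
  "inflation E i \<longleftrightarrow> (\<exists>p. (i, p) \<in> E)"

definition deflation :: "('m \<times> 'm) set \<Rightarrow> 'm \<Rightarrow> bool" where
  "deflation E p \<longleftrightarrow> (\<exists>i. (i, p) \<in> E)"

text \<open>Quillen's axioms, except the following one, which Keller showed to be redundant: if \<open>p\<close> has a
  kernel and \<open>p \<cdot> g\<close> is a deflation then \<open>p\<close> is a deflation, and dually.\<close>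

locale exact_category = additive_category C
  for C :: "('o, 'm, 'x) preadd_cat_scheme" (structure) and E :: "('m \<times> 'm) set" +
  assumes kernel_cokernel: "E \<subseteq> kernel_cokernel_pairs C"
    and split_exact: "is_biproduct C X Z S i j p q \<Longrightarrow> (i, q) \<in> E"
    and iso_closed: "\<lbrakk>(i, p) \<in> E; i \<in> mor C X Y; p \<in> mor C Y Z; i' \<in> mor C X' Y'; p' \<in> mor C Y' Z';
      a \<in> iso_mor C X X'; b \<in> iso_mor C Y Y'; c \<in> iso_mor C Z Z';
      b \<cdot> i = i' \<cdot> a; c \<cdot> p = p' \<cdot> b\<rbrakk> \<Longrightarrow> (i', p') \<in> E"
    and inflation_comp: "\<lbrakk>inflation E i; inflation E i'; tgt C i = src C i'\<rbrakk> \<Longrightarrow> inflation E (i' \<cdot> i)"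
    and deflation_comp: "\<lbrakk>deflation E p; deflation E p'; tgt C p = src C p'\<rbrakk> \<Longrightarrow> deflation E (p' \<cdot> p)"
    and inflation_pushout: "\<lbrakk>inflation E i; f \<in> arr C; src C f = src C i\<rbrakk> \<Longrightarrow>
      \<exists>i' f'. is_pushout C i f i' f' \<and> inflation E i'"
    and deflation_pullback: "\<lbrakk>deflation E p; f \<in> arr C; tgt C f = tgt C p\<rbrakk> \<Longrightarrow>
      \<exists>p' f'. is_pullback C p f p' f' \<and> deflation E p'"

definition full_subcategory ::
    "('o, 'm, 'x) preadd_cat_scheme \<Rightarrow> 'o set \<Rightarrow> ('o, 'm, 'x) preadd_cat_scheme" where
  "full_subcategory C S = C\<lparr>obj := S, arr := {f \<in> arr C. src C f \<in> S \<and> tgt C f \<in> S}\<rparr>"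

definition induced_exact_structure ::
    "('o, 'm, 'x) preadd_cat_scheme \<Rightarrow> ('m \<times> 'm) set \<Rightarrow> 'o set \<Rightarrow> ('m \<times> 'm) set" where
  "induced_exact_structure C E S =
    {(i, p) \<in> E. i \<in> arr (full_subcategory C S) \<and> p \<in> arr (full_subcategory C S)}"

text \<open>The set \<open>S\<close> of objects need not be closed under isomorphism, so closure under extensions is
  only asked up to isomorphism. An exact category has a zero object, so \<open>S\<close> must contain one; this
  does not follow from closure under extensions.\<close>

definition full_exact_subcategory ::
    "('o, 'm, 'x) preadd_cat_scheme \<Rightarrow> ('m \<times> 'm) set \<Rightarrow> 'o set \<Rightarrow> bool" where
  "full_exact_subcategory C E S \<longleftrightarrow> S \<subseteq> obj C \<and> (\<exists>Z \<in> S. zero_object C Z) \<and>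
    (\<forall>i p. (i, p) \<in> E \<and> src C i \<in> S \<and> tgt C p \<in> S \<longrightarrow> (\<exists>Y \<in> S. isomorphic C (tgt C i) Y))"

section \<open>The Grothendieck monoid\<close>

definition iso_class :: "('o, 'm, 'x) cat_scheme \<Rightarrow> 'o \<Rightarrow> 'o set" where
  "iso_class C X = {Y \<in> obj C. isomorphic C X Y}"

definition Iso :: "('o, 'm, 'x) cat_scheme \<Rightarrow> 'o set set" where
  "Iso C = iso_class C ` obj C"

text \<open>The sum of the classes of \<open>X\<close> and \<open>Y\<close> is the class of \<open>X \<oplus> Y\<close>, that is, the set of all
  biproducts of members of the two classes; the neutral element is the class of zero objects.\<close>

definition Iso_monoid :: "('o, 'm, 'x) preadd_cat_scheme \<Rightarrow> 'o set monoid" where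
  "Iso_monoid C = \<lparr>carrier = Iso C,
    mult = (\<lambda>x y. {S. \<exists>X \<in> x. \<exists>Y \<in> y. \<exists>i j p q. is_biproduct C X Y S i j p q}),
    one = {Z. zero_object C Z}\<rparr>"

text \<open>\<open>Ext C E A B\<close> consists of the classes of middle terms \<open>X\<close> in \<open>B \<rightarrowtail> X \<twoheadrightarrow> A\<close>. By
  \<open>iso_closed\<close> it depends only on the isomorphism classes of \<open>A\<close> and \<open>B\<close>.\<close>

definition Ext :: "('o, 'm, 'x) preadd_cat_scheme \<Rightarrow> ('m \<times> 'm) set \<Rightarrow> 'o \<Rightarrow> 'o \<Rightarrow> 'o set set" where
  "Ext C E A B = {iso_class C X | X. X \<in> obj C \<and> (\<exists>(i, p) \<in> E. i \<in> mor C B X \<and> p \<in> mor C X A)}"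

definition grothendieck_cong ::
    "('o, 'm, 'x) preadd_cat_scheme \<Rightarrow> ('m \<times> 'm) set \<Rightarrow> ('o set \<times> 'o set) set" where
  "grothendieck_cong C E =
    {(x, y). \<exists>M \<in> obj C. \<exists>N \<in> obj C. x \<in> Ext C E M N \<and> y \<in> Ext C E M N}\<^sup>+"

definition grothendieck_monoid ::
    "('o, 'm, 'x) preadd_cat_scheme \<Rightarrow> ('m \<times> 'm) set \<Rightarrow> 'o set set monoid" where
  "grothendieck_monoid C E = \<lparr>carrier = Iso C // grothendieck_cong C E,
    mult = (\<lambda>\<gamma> \<delta>. \<Union>x \<in> \<gamma>. \<Union>y \<in> \<delta>. grothendieck_cong C E `` {x \<otimes>\<^bsub>Iso_monoid C\<^esub> y}),
    one = grothendieck_cong C E `` {\<one>\<^bsub>Iso_monoid C\<^esub>}\<rparr>"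

definition Iso_fiber ::
    "('o, 'm, 'x) preadd_cat_scheme \<Rightarrow> ('m \<times> 'm) set \<Rightarrow> 'o set set \<Rightarrow> 'o set set" where
  "Iso_fiber C E \<gamma> = {x \<in> Iso C. grothendieck_cong C E `` {x} = \<gamma>}"

definition finitely_generated_monoid :: "('a, 'x) monoid_scheme \<Rightarrow> bool" where
  "finitely_generated_monoid M \<longleftrightarrow>
    (\<exists>G. finite G \<and> G \<subseteq> carrier M \<and> (\<forall>H. submonoid H M \<and> G \<subseteq> H \<longrightarrow> H = carrier M))"

section \<open>Profinitary and cofinitary exact categories\<close>

definition hom_finite :: "('o, 'm, 'x) cat_scheme \<Rightarrow> bool" where
  "hom_finite C \<longleftrightarrow> (\<forall>X \<in> obj C. \<forall>Y \<in> obj C. finite (mor C X Y))"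

definition profinitary :: "('o, 'm, 'x) preadd_cat_scheme \<Rightarrow> ('m \<times> 'm) set \<Rightarrow> bool" where
  "profinitary C E \<longleftrightarrow> exact_category C E \<and> hom_finite C \<and>
    (\<forall>\<gamma> \<in> carrier (grothendieck_monoid C E). finite (Iso_fiber C E \<gamma>))"

definition cofinitary :: "('o, 'm, 'x) preadd_cat_scheme \<Rightarrow> ('m \<times> 'm) set \<Rightarrow> bool" where
  "cofinitary C E \<longleftrightarrow> exact_category C E \<and> hom_finite C \<and>
    (\<forall>x \<in> Iso C. finite {(iso_class C A, iso_class C B) | A B.
      A \<in> obj C \<and> B \<in> obj C \<and> x \<in> Ext C E A B})"

end

theory Submission
  imports Defs
begin

text \<open>In any exact category, if \<open>[X]\<close> lies in \<open>Ext(A, B)\<close> then so does \<open>[B \<oplus> A]\<close>, so \<open>[B \<oplus> A]\<close> lies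
  in the fiber of the Grothendieck monoid through \<open>X\<close>, which is finite in the profinitary case. By
  Hom-finiteness each object has only finitely many retracts up to isomorphism, one for each
  idempotent at most, so only finitely many pairs \<open>([A], [B])\<close> occur: profinitary implies
  cofinitary. Cofinitarity passes to a full exact subcategory; that the induced structure is exact
  comes down to the facts that a pushout of an inflation has the same cokernel, and that the cokernel
  of a composite of inflations is an extension of the two cokernels.\<close>

section \<open>Morphisms, isomorphisms and retracts\<close>

text \<open>An arbitrary quotient or subobject of \<open>X\<close> cannot be read off from the
  finite set of endomorphisms of \<open>X\<close>, but a direct summand can, as the splitting of an
  idempotent. This is why \<open>X\<close> is traded for the split extension of \<open>A\<close> by
  \<open>B\<close>: both \<open>A\<close> and \<open>B\<close> are summands of it, and the only
  price is that one class is replaced by the finitely many classes in its fiber. Two obstacles shape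
  the second half. The set \<open>S\<close> need not be closed under isomorphism, so a pushout or
  cokernel object formed in the ambient category must be moved to a representative in
  \<open>S\<close>, together with its morphisms. And the pushout axiom returns an inflation without
  its deflation, which has to be identified by a universal property. The deflation axioms come from
  the inflation axioms in the opposite category, with exact structure
  \<open>E\<inverse>\<close>.\<close>

lemma mor_typeD:
  assumes "f \<in> mor C X Y" "f \<in> mor C X' Y'"
  shows "X' = X" "Y' = Y"
  using assms by (auto simp: mor_def)

text \<open>An arrow determines its source and target, so the quantified objects in
  \<open>is_kernel_def\<close> and \<open>is_cokernel_def\<close> are forced.
  \<open>ex_square_iff\<close> plays the same role for squares.\<close>

lemma ex_composable_iff:
  assumes "f \<in> mor C X Y" "g \<in> mor C Y Z"
  shows "(\<exists>X Y Z. f \<in> mor C X Y \<and> g \<in> mor C Y Z \<and> P X Y Z) \<longleftrightarrow> P X Y Z"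
  using assms by (auto simp: mor_def)

lemma is_kernel_iff:
  assumes "i \<in> mor C X Y" "p \<in> mor C Y Z"
  shows "is_kernel C p i \<longleftrightarrow> p \<cdot>\<^bsub>C\<^esub> i = mzero C X Z \<and>
    (\<forall>W. \<forall>f \<in> mor C W Y. p \<cdot>\<^bsub>C\<^esub> f = mzero C W Z \<longrightarrow> (\<exists>!g. g \<in> mor C W X \<and> i \<cdot>\<^bsub>C\<^esub> g = f))"
  unfolding is_kernel_def by (rule ex_composable_iff[OF assms])

lemma is_cokernel_iff:
  assumes "i \<in> mor C X Y" "p \<in> mor C Y Z"
  shows "is_cokernel C i p \<longleftrightarrow> p \<cdot>\<^bsub>C\<^esub> i = mzero C X Z \<and>
    (\<forall>W. \<forall>f \<in> mor C Y W. f \<cdot>\<^bsub>C\<^esub> i = mzero C X W \<longrightarrow> (\<exists>!g. g \<in> mor C Z W \<and> g \<cdot>\<^bsub>C\<^esub> p = f))"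
  unfolding is_cokernel_def by (rule ex_composable_iff[OF assms])

lemma ex_square_iff:
  assumes "i \<in> mor C X Y" "f \<in> mor C X X'" "i' \<in> mor C X' P" "f' \<in> mor C Y P"
  shows "(\<exists>X Y X' P. i \<in> mor C X Y \<and> f \<in> mor C X X' \<and> i' \<in> mor C X' P \<and> f' \<in> mor C Y P \<and> Q X Y X' P)
    \<longleftrightarrow> Q X Y X' P"
  using assms by (auto simp: mor_def)

lemma is_pushout_iff:
  assumes "i \<in> mor C X Y" "f \<in> mor C X X'" "i' \<in> mor C X' P" "f' \<in> mor C Y P"
  shows "is_pushout C i f i' f' \<longleftrightarrow> f' \<cdot>\<^bsub>C\<^esub> i = i' \<cdot>\<^bsub>C\<^esub> f \<and>
    (\<forall>Q. \<forall>u \<in> mor C Y Q. \<forall>v \<in> mor C X' Q. u \<cdot>\<^bsub>C\<^esub> i = v \<cdot>\<^bsub>C\<^esub> f \<longrightarrow>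
      (\<exists>!w. w \<in> mor C P Q \<and> w \<cdot>\<^bsub>C\<^esub> f' = u \<and> w \<cdot>\<^bsub>C\<^esub> i' = v))"
  unfolding is_pushout_def by (rule ex_square_iff[OF assms])

lemma iso_morE:
  assumes "u \<in> iso_mor C X Y"
  obtains v where "u \<in> mor C X Y" "v \<in> mor C Y X" "v \<cdot>\<^bsub>C\<^esub> u = ident C X" "u \<cdot>\<^bsub>C\<^esub> v = ident C Y"
  using assms by (auto simp: iso_mor_def)

lemma iso_morI:
  assumes "u \<in> mor C X Y" "v \<in> mor C Y X" "v \<cdot>\<^bsub>C\<^esub> u = ident C X" "u \<cdot>\<^bsub>C\<^esub> v = ident C Y"
  shows "u \<in> iso_mor C X Y"
  using assms by (auto simp: iso_mor_def)

context category
begin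

lemma mor_obj: "f \<in> mor C X Y \<Longrightarrow> X \<in> obj C" "f \<in> mor C X Y \<Longrightarrow> Y \<in> obj C"
  using src_obj tgt_obj by (auto simp: mor_def)

lemma ident_iso: "X \<in> obj C \<Longrightarrow> ident C X \<in> iso_mor C X X"
  by (meson comp_ident ident_mor iso_morI)

text \<open>The category axioms mention intermediate objects that occur only in premises, which
  rewriting would have to guess. With \<open>src\<close> and \<open>tgt\<close> in their place, the
  rules in \<open>arr_simps\<close> can rebracket composites unaided.\<close>

lemma comp_arr:
  assumes "f \<in> arr C" "g \<in> arr C" "tgt C f = src C g"
  shows "g \<cdot> f \<in> arr C" "src C (g \<cdot> f) = src C f" "tgt C (g \<cdot> f) = tgt C g"
  using comp_mor[of f "src C f" "tgt C f" g "tgt C g"] assms by (auto simp: mor_def)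

lemma comp_assoc_arr:
  assumes "f \<in> arr C" "g \<in> arr C" "h \<in> arr C" "tgt C f = src C g" "tgt C g = src C h"
  shows "(h \<cdot> g) \<cdot> f = h \<cdot> (g \<cdot> f)"
  using comp_assoc[of f "src C f" "tgt C f" g "tgt C g" h "tgt C h"] assms by (auto simp: mor_def)

lemma ident_comp_arr: "f \<in> arr C \<Longrightarrow> tgt C f = Y \<Longrightarrow> ident C Y \<cdot> f = f"
  using ident_comp[of f "src C f" "tgt C f"] by (auto simp: mor_def)

lemma comp_ident_arr: "f \<in> arr C \<Longrightarrow> src C f = X \<Longrightarrow> f \<cdot> ident C X = f"
  using comp_ident[of f "src C f" "tgt C f"] by (auto simp: mor_def)

lemmas arr_simps = mor_def comp_arr comp_assoc_arr ident_comp_arr comp_ident_arr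

text \<open>Transport along \<open>u\<close> composes incoming maps with \<open>u\<close> and
  outgoing maps with its inverse \<open>v\<close>; this rule says that their composites do not
  change.\<close>

lemma cancel_middle:
  assumes "f \<in> mor C W X" "u \<in> mor C X Y" "v \<in> mor C Y X" "g \<in> mor C X Z" "v \<cdot> u = ident C X"
  shows "(g \<cdot> v) \<cdot> (u \<cdot> f) = g \<cdot> f"
proof -
  have "(g \<cdot> v) \<cdot> (u \<cdot> f) = g \<cdot> ((v \<cdot> u) \<cdot> f)"
    using assms(1-4) by (simp add: arr_simps)
  then show ?thesis
    using assms by (simp add: ident_comp)
qed

lemma cancel_left:
  assumes "f \<in> mor C W X" "u \<in> mor C X Y" "v \<in> mor C Y X" "v \<cdot> u = ident C X"
  shows "v \<cdot> (u \<cdot> f) = f"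
  using comp_assoc[OF assms(1-3)] assms ident_comp by simp

lemma cancel_right:
  assumes "u \<in> mor C X Y" "v \<in> mor C Y X" "g \<in> mor C X Z" "v \<cdot> u = ident C X"
  shows "(g \<cdot> v) \<cdot> u = g"
  using comp_assoc[OF assms(1-3)] assms comp_ident by simp

lemma iso_comp:
  assumes "f \<in> iso_mor C X Y" "g \<in> iso_mor C Y Z"
  shows "g \<cdot> f \<in> iso_mor C X Z"
proof -
  obtain f' where f: "f \<in> mor C X Y" "f' \<in> mor C Y X" "f' \<cdot> f = ident C X" "f \<cdot> f' = ident C Y"
    using assms(1) by (rule iso_morE)
  obtain g' where g: "g \<in> mor C Y Z" "g' \<in> mor C Z Y" "g' \<cdot> g = ident C Y" "g \<cdot> g' = ident C Z"
    using assms(2) by (rule iso_morE)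
  show ?thesis
  proof (rule iso_morI)
    show "g \<cdot> f \<in> mor C X Z" "f' \<cdot> g' \<in> mor C Z X"
      using f g comp_mor by blast+
    show "(f' \<cdot> g') \<cdot> (g \<cdot> f) = ident C X" "(g \<cdot> f) \<cdot> (f' \<cdot> g') = ident C Z"
      using f g cancel_middle[OF f(1) g(1,2) f(2) g(3)] cancel_middle[OF g(2) f(2) f(1) g(1) f(4)]
      by simp_all
  qed
qed

lemma isomorphic_refl: "X \<in> obj C \<Longrightarrow> isomorphic C X X"
  using ident_iso unfolding isomorphic_def by blast

lemma isomorphic_sym: "isomorphic C X Y \<Longrightarrow> isomorphic C Y X"
  unfolding isomorphic_def by (metis all_not_in_conv iso_morE iso_morI)

lemma isomorphic_trans: "isomorphic C X Y \<Longrightarrow> isomorphic C Y Z \<Longrightarrow> isomorphic C X Z"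
  unfolding isomorphic_def using iso_comp by blast

lemma iso_class_eqI:
  assumes "isomorphic C X Y"
  shows "iso_class C X = iso_class C Y"
  using assms isomorphic_sym isomorphic_trans unfolding iso_class_def by blast

lemma iso_class_eqD:
  assumes "iso_class C X = iso_class C Y" "Y \<in> obj C"
  shows "isomorphic C X Y"
  using assms isomorphic_refl unfolding iso_class_def by blast

definition retract :: "'o \<Rightarrow> 'o \<Rightarrow> bool" where
  "retract X Y \<longleftrightarrow> (\<exists>r \<in> mor C X Y. \<exists>s \<in> mor C Y X. s \<cdot> r = ident C X)"

text \<open>A retract is determined up to isomorphism by its idempotent \<open>r \<cdot> s\<close>.\<close>

lemma finite_retract_classes:
  assumes "finite (mor C Y Y)"
  shows "finite {iso_class C X | X. retract X Y}"
proof -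
  \<comment> \<open>Two splittings of one idempotent are isomorphic, so \<open>?R\<close> is a
    partial function from endomorphisms \<open>e\<close> to classes \<open>c\<close>.\<close>
  let ?R = "\<lambda>e c. \<exists>X. c = iso_class C X \<and>
    (\<exists>r \<in> mor C X Y. \<exists>s \<in> mor C Y X. s \<cdot> r = ident C X \<and> r \<cdot> s = e)"
  have unique: "c = c'" if "?R e c" "?R e c'" for e c c'
  proof -
    obtain X r s where X: "c = iso_class C X" "r \<in> mor C X Y" "s \<in> mor C Y X"
      "s \<cdot> r = ident C X" "r \<cdot> s = e"
      using \<open>?R e c\<close> by blast
    obtain X' r' s' where X': "c' = iso_class C X'" "r' \<in> mor C X' Y" "s' \<in> mor C Y X'"
      "s' \<cdot> r' = ident C X'" "r' \<cdot> s' = e"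
      using \<open>?R e c'\<close> by blast
    \<comment> \<open>The inner factor \<open>q' \<cdot> t'\<close> becomes
      \<open>q \<cdot> t\<close>, which leaves \<open>(t \<cdot> q) \<cdot> (t \<cdot> q)\<close>.
      The general form serves both directions of the isomorphism.\<close>
    have inverse: "(t \<cdot> q') \<cdot> (t' \<cdot> q) = ident C Z"
      if "q \<in> mor C Z Y" "t \<in> mor C Y Z" "t \<cdot> q = ident C Z"
        "q' \<in> mor C Z' Y" "t' \<in> mor C Y Z'" "q' \<cdot> t' = q \<cdot> t" for Z Z' q t q' t'
    proof -
      have "(t \<cdot> q') \<cdot> (t' \<cdot> q) = t \<cdot> ((q' \<cdot> t') \<cdot> q)"
        using that(1-5) by (simp add: arr_simps)
      also have "\<dots> = (t \<cdot> q) \<cdot> (t \<cdot> q)"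
        unfolding that(6) using that(1,2) by (simp add: arr_simps)
      also have "\<dots> = ident C Z"
        using that(1,3) ident_mor comp_ident mor_obj by metis
      finally show ?thesis .
    qed
    have "(s \<cdot> r') \<cdot> (s' \<cdot> r) = ident C X"
      using X X' by (intro inverse) auto
    moreover have "(s' \<cdot> r) \<cdot> (s \<cdot> r') = ident C X'"
      using X X' by (intro inverse) auto
    ultimately have "s' \<cdot> r \<in> iso_mor C X X'"
      using X X' comp_mor by (intro iso_morI) auto
    then show ?thesis
      using X(1) X'(1) iso_class_eqI unfolding isomorphic_def by blast
  qed
  \<comment> \<open>At an endomorphism that does not split, the description has an arbitrary value,
    which merely enlarges the finite covering set.\<close>
  have "{iso_class C X | X. retract X Y} \<subseteq> (\<lambda>e. THE c. ?R e c) ` mor C Y Y"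
  proof
    fix c assume "c \<in> {iso_class C X | X. retract X Y}"
    then obtain e where e: "e \<in> mor C Y Y" "?R e c"
      unfolding retract_def using comp_mor by blast
    then have "(THE c. ?R e c) = c"
      using unique by (intro the_equality) blast+
    then show "c \<in> (\<lambda>e. THE c. ?R e c) ` mor C Y Y"
      using e(1) by blast
  qed
  then show ?thesis
    using assms finite_surj by blast
qed

text \<open>The pushout object given by the exactness axioms may lie outside \<open>S\<close>; this
  lets an isomorphic object of \<open>S\<close> serve instead.\<close>

lemma is_pushout_iso:
  assumes po: "is_pushout C i f i' f'"
    and typing: "i \<in> mor C X Y" "f \<in> mor C X X'" "i' \<in> mor C X' P" "f' \<in> mor C Y P"
    and u: "u \<in> iso_mor C P P'"
  shows "is_pushout C i f (u \<cdot> i') (u \<cdot> f')"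
proof -
  obtain v where uv: "u \<in> mor C P P'" "v \<in> mor C P' P" "v \<cdot> u = ident C P" "u \<cdot> v = ident C P'"
    using u by (rule iso_morE)
  note po' = po[unfolded is_pushout_iff[OF typing]]
  have typing': "u \<cdot> i' \<in> mor C X' P'" "u \<cdot> f' \<in> mor C Y P'"
    using typing uv comp_mor by blast+
  have "\<exists>!w. w \<in> mor C P' Q \<and> w \<cdot> (u \<cdot> f') = g \<and> w \<cdot> (u \<cdot> i') = h"
    if "g \<in> mor C Y Q" "h \<in> mor C X' Q" "g \<cdot> i = h \<cdot> f" for Q g h
  proof -
    have "\<exists>!w. w \<in> mor C P Q \<and> w \<cdot> f' = g \<and> w \<cdot> i' = h"
      using po' that by blast
    then obtain w where w: "w \<in> mor C P Q" "w \<cdot> f' = g" "w \<cdot> i' = h"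
      and unique: "\<And>w'. w' \<in> mor C P Q \<Longrightarrow> w' \<cdot> f' = g \<Longrightarrow> w' \<cdot> i' = h \<Longrightarrow> w' = w"
      by blast
    show ?thesis
    proof (rule ex1I[of _ "w \<cdot> v"], intro conjI)
      show "w \<cdot> v \<in> mor C P' Q" "(w \<cdot> v) \<cdot> (u \<cdot> f') = g" "(w \<cdot> v) \<cdot> (u \<cdot> i') = h"
        using w comp_mor[OF uv(2) w(1)]
          cancel_middle[OF typing(4) uv(1,2) w(1) uv(3)] cancel_middle[OF typing(3) uv(1,2) w(1) uv(3)]
        by simp_all
      fix w' assume w': "w' \<in> mor C P' Q \<and> w' \<cdot> (u \<cdot> f') = g \<and> w' \<cdot> (u \<cdot> i') = h"
      then have "w' \<cdot> u = w"
        using uv typing by (intro unique) (simp_all add: arr_simps)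
      moreover have "(w' \<cdot> u) \<cdot> v = w'"
        using w' uv by (intro cancel_right[of v P' P]) auto
      ultimately show "w' = w \<cdot> v"
        by simp
    qed
  qed
  moreover have "(u \<cdot> f') \<cdot> i = (u \<cdot> i') \<cdot> f"
    using po' comp_assoc[OF typing(1,4) uv(1)] comp_assoc[OF typing(2,3) uv(1)] by simp
  ultimately show ?thesis
    unfolding is_pushout_iff[OF typing(1,2) typing'] by blast
qed

end

section \<open>Zero morphisms, cokernels and biproducts\<close>

context preadditive_category
begin

lemma mzero_mor: "X \<in> obj C \<Longrightarrow> Y \<in> obj C \<Longrightarrow> mzero C X Y \<in> mor C X Y"
  using hom_comm_group[of X Y] monoid.one_closed[of "hom_group C X Y"]
  by (simp add: hom_group_def comm_group_def group_def)

text \<open>Cancellation in the Hom group. By bilinearity a composite with a zero morphism is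
  additively idempotent, which is how the next two lemmas show that it is zero.\<close>

lemma msum_idem_zero:
  assumes "f \<in> mor C X Y" "f \<boxplus> f = f"
  shows "f = mzero C X Y"
proof -
  interpret comm_group "hom_group C X Y"
    using assms mor_obj by (blast intro: hom_comm_group)
  show ?thesis
    using assms l_cancel_one[of f f] by (simp add: hom_group_def)
qed

lemma comp_mzero_left:
  assumes "f \<in> mor C X Y" "Z \<in> obj C"
  shows "mzero C Y Z \<cdot> f = mzero C X Z"
proof (rule msum_idem_zero)
  have z: "mzero C Y Z \<in> mor C Y Z"
    using assms mor_obj mzero_mor by blast
  then show "mzero C Y Z \<cdot> f \<in> mor C X Z"
    using assms comp_mor by blast
  interpret comm_group "hom_group C Y Z"
    using assms mor_obj by (blast intro: hom_comm_group)
  have "mzero C Y Z \<boxplus> mzero C Y Z = mzero C Y Z"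
    using l_one[OF one_closed] by (simp add: hom_group_def)
  then show "mzero C Y Z \<cdot> f \<boxplus> mzero C Y Z \<cdot> f = mzero C Y Z \<cdot> f"
    using comp_sum_left[OF assms(1) z z] by simp
qed

lemma comp_mzero_right:
  assumes "f \<in> mor C Y Z" "X \<in> obj C"
  shows "f \<cdot> mzero C X Y = mzero C X Z"
proof (rule msum_idem_zero)
  have z: "mzero C X Y \<in> mor C X Y"
    using assms mor_obj mzero_mor by blast
  then show "f \<cdot> mzero C X Y \<in> mor C X Z"
    using assms comp_mor by blast
  interpret comm_group "hom_group C X Y"
    using assms mor_obj by (blast intro: hom_comm_group)
  have "mzero C X Y \<boxplus> mzero C X Y = mzero C X Y"
    using l_one[OF one_closed] by (simp add: hom_group_def)
  then show "f \<cdot> mzero C X Y \<boxplus> f \<cdot> mzero C X Y = f \<cdot> mzero C X Y"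
    using comp_sum_right[OF z z assms(1)] by simp
qed

lemma is_cokernel_unique:
  assumes "i \<in> mor C X Y" "p \<in> mor C Y Z" "p' \<in> mor C Y Z'"
    and "is_cokernel C i p" "is_cokernel C i p'"
  shows "\<exists>a \<in> iso_mor C Z Z'. a \<cdot> p = p'"
proof -
  have p: "p \<cdot> i = mzero C X Z"
    "\<And>W f. f \<in> mor C Y W \<Longrightarrow> f \<cdot> i = mzero C X W \<Longrightarrow> \<exists>!g. g \<in> mor C Z W \<and> g \<cdot> p = f"
    using assms(4) unfolding is_cokernel_iff[OF assms(1,2)] by blast+
  have p': "p' \<cdot> i = mzero C X Z'"
    "\<And>W f. f \<in> mor C Y W \<Longrightarrow> f \<cdot> i = mzero C X W \<Longrightarrow> \<exists>!g. g \<in> mor C Z' W \<and> g \<cdot> p' = f"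
    using assms(5) unfolding is_cokernel_iff[OF assms(1,3)] by blast+
  obtain a where a: "a \<in> mor C Z Z'" "a \<cdot> p = p'"
    using p(2)[OF assms(3) p'(1)] by blast
  obtain b where b: "b \<in> mor C Z' Z" "b \<cdot> p' = p"
    using p'(2)[OF assms(2) p(1)] by blast
  have "(b \<cdot> a) \<cdot> p = p" "ident C Z \<cdot> p = p" "(a \<cdot> b) \<cdot> p' = p'" "ident C Z' \<cdot> p' = p'"
    using a b comp_assoc[OF assms(2) a(1) b(1)] comp_assoc[OF assms(3) b(1) a(1)]
      ident_comp[OF assms(2)] ident_comp[OF assms(3)] by simp_all
  moreover have "b \<cdot> a \<in> mor C Z Z" "ident C Z \<in> mor C Z Z"
    "a \<cdot> b \<in> mor C Z' Z'" "ident C Z' \<in> mor C Z' Z'"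
    using a b comp_mor ident_mor mor_obj by blast+
  ultimately have "b \<cdot> a = ident C Z" "a \<cdot> b = ident C Z'"
    using p(2)[OF assms(2) p(1)] p'(2)[OF assms(3) p'(1)] by blast+
  then show ?thesis
    using a b iso_morI by metis
qed

text \<open>The cokernel \<open>p\<close> of \<open>i\<close> and the zero morphism out of
  \<open>X'\<close> form a cocone, which induces \<open>w\<close>. A morphism \<open>g\<close>
  killing \<open>i'\<close> is determined by \<open>g \<cdot> f'\<close>, which kills
  \<open>i\<close>; so factorizations through \<open>w\<close> correspond to factorizations through
  \<open>p\<close>.\<close>

lemma is_pushout_cokernel:
  assumes po: "is_pushout C i f i' f'" and coker: "is_cokernel C i p"
    and typing: "i \<in> mor C X Y" "p \<in> mor C Y Z" "f \<in> mor C X X'" "i' \<in> mor C X' P" "f' \<in> mor C Y P"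
  shows "\<exists>w \<in> mor C P Z. w \<cdot> f' = p \<and> is_cokernel C i' w"
proof -
  note po = po[unfolded is_pushout_iff[OF typing(1,3,4,5)]]
  note coker = coker[unfolded is_cokernel_iff[OF typing(1,2)]]
  have obj: "X \<in> obj C" "X' \<in> obj C" "Z \<in> obj C"
    using typing mor_obj by blast+
  have z: "mzero C X' Z \<in> mor C X' Z"
    using obj mzero_mor by blast
  have "p \<cdot> i = mzero C X' Z \<cdot> f"
    using coker comp_mzero_left[OF typing(3) obj(3)] by simp
  then obtain w where w: "w \<in> mor C P Z" "w \<cdot> f' = p" "w \<cdot> i' = mzero C X' Z"
    using po typing(2) z by blast
  have "\<exists>!h. h \<in> mor C Z Q \<and> h \<cdot> w = g" if g: "g \<in> mor C P Q" "g \<cdot> i' = mzero C X' Q" for Q g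
  proof -
    have Q: "Q \<in> obj C"
      using g mor_obj by blast
    have gf: "g \<cdot> f' \<in> mor C Y Q"
      using g typing comp_mor by blast
    have "(g \<cdot> f') \<cdot> i = (g \<cdot> i') \<cdot> f"
      using comp_assoc[OF typing(1,5) g(1)] comp_assoc[OF typing(3,4) g(1)] po by simp
    also have "\<dots> = mzero C X Q"
      using g(2) comp_mzero_left[OF typing(3) Q] by simp
    finally have eq: "(g \<cdot> f') \<cdot> i = mzero C X Q" .
    have "\<exists>!h. h \<in> mor C Z Q \<and> h \<cdot> p = g \<cdot> f'"
      using coker gf eq by blast
    then obtain h where h: "h \<in> mor C Z Q" "h \<cdot> p = g \<cdot> f'"
      and unique: "\<And>h'. h' \<in> mor C Z Q \<Longrightarrow> h' \<cdot> p = g \<cdot> f' \<Longrightarrow> h' = h"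
      by blast
    \<comment> \<open>\<open>h \<cdot> w\<close> and \<open>g\<close> agree after both legs of the
      pushout, hence coincide.\<close>
    have "(h \<cdot> w) \<cdot> f' = g \<cdot> f'"
      using comp_assoc[OF typing(5) w(1) h(1)] w h by simp
    moreover have "(h \<cdot> w) \<cdot> i' = g \<cdot> i'"
      using comp_assoc[OF typing(4) w(1) h(1)] w(3) comp_mzero_right[OF h(1) obj(2)] g(2) by simp
    moreover have "h \<cdot> w \<in> mor C P Q" "g \<cdot> i' \<in> mor C X' Q" "(g \<cdot> f') \<cdot> i = (g \<cdot> i') \<cdot> f"
      using comp_mor h w g typing \<open>(g \<cdot> f') \<cdot> i = (g \<cdot> i') \<cdot> f\<close> by blast+
    moreover have "\<exists>!k. k \<in> mor C P Q \<and> k \<cdot> f' = g \<cdot> f' \<and> k \<cdot> i' = g \<cdot> i'"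
      using po gf calculation by blast
    ultimately have "h \<cdot> w = g"
      using g(1) by blast
    moreover have "h' = h" if "h' \<in> mor C Z Q" "h' \<cdot> w = g" for h'
      using that unique comp_assoc[OF typing(5) w(1) that(1)] w(2) by simp
    ultimately show ?thesis
      using h(1) by blast
  qed
  then have "is_cokernel C i' w"
    unfolding is_cokernel_iff[OF typing(4) w(1)] using w(3) by blast
  then show ?thesis
    using w by blast
qed

text \<open>If \<open>f\<close> kills \<open>i' \<cdot> i\<close>, then \<open>f \<cdot> i'\<close>
  factors uniquely through the cokernel \<open>p\<close>. So \<open>f\<close> is one half of a
  cocone over the span of \<open>i'\<close> and \<open>p\<close>, and it determines the other half.
  For modules, \<open>Q\<close> is \<open>Y'\<close> modulo \<open>X\<close>.\<close>

lemma is_pushout_cokernel_comp: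
  assumes po: "is_pushout C i' p i'' q" and coker: "is_cokernel C i p"
    and typing: "i \<in> mor C X Y" "p \<in> mor C Y Z" "i' \<in> mor C Y Y'" "i'' \<in> mor C Z Q" "q \<in> mor C Y' Q"
  shows "is_cokernel C (i' \<cdot> i) q"
proof -
  note po = po[unfolded is_pushout_iff[OF typing(3,2,4,5)]]
  note coker = coker[unfolded is_cokernel_iff[OF typing(1,2)]]
  have "q \<cdot> (i' \<cdot> i) = i'' \<cdot> (p \<cdot> i)"
    using comp_assoc[OF typing(1,3,5)] comp_assoc[OF typing(1,2,4)] po by simp
  also have "\<dots> = mzero C X Q"
    using coker comp_mzero_right[OF typing(4)] mor_obj(1)[OF typing(1)] by simp
  finally have zero: "q \<cdot> (i' \<cdot> i) = mzero C X Q" .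
  have "\<exists>!g. g \<in> mor C Q W \<and> g \<cdot> q = f" if f: "f \<in> mor C Y' W" "f \<cdot> (i' \<cdot> i) = mzero C X W" for f W
  proof -
    have fi: "f \<cdot> i' \<in> mor C Y W" "(f \<cdot> i') \<cdot> i = mzero C X W"
      using f comp_mor[OF typing(3) f(1)] comp_assoc[OF typing(1,3) f(1)] by simp_all
    then have "\<exists>!h. h \<in> mor C Z W \<and> h \<cdot> p = f \<cdot> i'"
      using coker by blast
    then obtain h where h: "h \<in> mor C Z W" "h \<cdot> p = f \<cdot> i'"
      and h_unique: "\<And>h'. h' \<in> mor C Z W \<Longrightarrow> h' \<cdot> p = f \<cdot> i' \<Longrightarrow> h' = h"
      by blast
    have "\<exists>!g. g \<in> mor C Q W \<and> g \<cdot> q = f \<and> g \<cdot> i'' = h"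
      using po f(1) h(1) h(2)[symmetric] by blast
    then obtain g where g: "g \<in> mor C Q W" "g \<cdot> q = f" "g \<cdot> i'' = h"
      and unique: "\<And>g'. g' \<in> mor C Q W \<Longrightarrow> g' \<cdot> q = f \<Longrightarrow> g' \<cdot> i'' = h \<Longrightarrow> g' = g"
      by blast
    \<comment> \<open>Uniqueness in the pushout also asks for \<open>g' \<cdot> i''\<close>; this is
      forced, since its composite with \<open>p\<close> is \<open>f \<cdot> i'\<close>.\<close>
    have "g' = g" if g': "g' \<in> mor C Q W" "g' \<cdot> q = f" for g'
    proof (rule unique[OF g' h_unique])
      show "g' \<cdot> i'' \<in> mor C Z W"
        using g' typing comp_mor by blast
      show "(g' \<cdot> i'') \<cdot> p = f \<cdot> i'"
        using g' po comp_assoc[OF typing(2,4) g'(1)] comp_assoc[OF typing(3,5) g'(1)] by simp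
    qed
    then show ?thesis
      using g by blast
  qed
  then show ?thesis
    unfolding is_cokernel_iff[OF comp_mor[OF typing(1,3)] typing(5)] using zero by blast
qed

lemma is_biproduct_iso:
  assumes bi: "is_biproduct C X Y T i j p q" and u: "u \<in> mor C T T'" "v \<in> mor C T' T"
    "v \<cdot> u = ident C T" "u \<cdot> v = ident C T'"
  shows "is_biproduct C X Y T' (u \<cdot> i) (u \<cdot> j) (p \<cdot> v) (q \<cdot> v)"
proof -
  have bi': "i \<in> mor C X T" "j \<in> mor C Y T" "p \<in> mor C T X" "q \<in> mor C T Y"
    "p \<cdot> i = ident C X" "q \<cdot> j = ident C Y" "p \<cdot> j = mzero C Y X" "q \<cdot> i = mzero C X Y"
    "(i \<cdot> p) \<boxplus> (j \<cdot> q) = ident C T"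
    using bi unfolding is_biproduct_def by blast+
  have ip: "i \<cdot> p \<in> mor C T T" and jq: "j \<cdot> q \<in> mor C T T"
    using bi' comp_mor by blast+
  \<comment> \<open>Rebracketed so that distributivity pulls \<open>u\<close> and \<open>v\<close>
    out of the sum and leaves the identity of \<open>T\<close> between them.\<close>
  have "u \<cdot> i \<cdot> (p \<cdot> v) = u \<cdot> (i \<cdot> p) \<cdot> v" "u \<cdot> j \<cdot> (q \<cdot> v) = u \<cdot> (j \<cdot> q) \<cdot> v"
    using bi'(1-4) u(1,2) by (simp_all add: arr_simps)
  then have "(u \<cdot> i \<cdot> (p \<cdot> v)) \<boxplus> (u \<cdot> j \<cdot> (q \<cdot> v)) = u \<cdot> ((i \<cdot> p) \<boxplus> (j \<cdot> q)) \<cdot> v"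
    using comp_sum_right[OF ip jq u(1)] comp_sum_left[OF u(2) comp_mor[OF ip u(1)] comp_mor[OF jq u(1)]]
    by simp
  also have "\<dots> = ident C T'"
    using bi'(9) u comp_ident by simp
  finally show ?thesis
    unfolding is_biproduct_def using bi' u comp_mor[OF _ u(1)] comp_mor[OF u(2)] cancel_middle
    by simp
qed

end

section \<open>Profinitary exact categories are cofinitary\<close>

lemma (in exact_category) E_typeE:
  assumes "(i, p) \<in> E"
  obtains X Y Z where "i \<in> mor C X Y" "p \<in> mor C Y Z" "is_kernel C p i" "is_cokernel C i p"
proof -
  have "is_kernel C p i" "is_cokernel C i p"
    using assms kernel_cokernel unfolding kernel_cokernel_pairs_def by auto
  moreover from this obtain X Y Z where "i \<in> mor C X Y" "p \<in> mor C Y Z"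
    unfolding is_kernel_def by blast
  ultimately show ?thesis
    using that by blast
qed

text \<open>Carrying the biproduct along the isomorphism from \<open>T\<close> to \<open>Y\<close>
  exhibits \<open>A\<close> and \<open>B\<close> as retracts of \<open>Y\<close>. \<open>B\<close>
  comes first because it is the subobject in \<open>Ext C E A B\<close>.\<close>

lemma (in preadditive_category) finite_decompositions:
  assumes "finite (mor C Y Y)"
  shows "finite {(iso_class C A, iso_class C B) | A B. \<exists>T i j p q.
    is_biproduct C B A T i j p q \<and> isomorphic C T Y}" (is "finite ?D")
proof -
  have "retract A Y \<and> retract B Y" if bi: "is_biproduct C B A T i j p q" and "isomorphic C T Y" for A B T i j p q
  proof -
    obtain u v where uv: "u \<in> mor C T Y" "v \<in> mor C Y T" "v \<cdot> u = ident C T" "u \<cdot> v = ident C Y"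
      using \<open>isomorphic C T Y\<close> unfolding isomorphic_def by (metis all_not_in_conv iso_morE)
    then show ?thesis
      using is_biproduct_iso[OF bi uv] unfolding is_biproduct_def retract_def by blast
  qed
  then have "?D \<subseteq> {iso_class C X | X. retract X Y} \<times> {iso_class C X | X. retract X Y}"
    by blast
  moreover have "finite ({iso_class C X | X. retract X Y} \<times> {iso_class C X | X. retract X Y})"
    by (intro finite_cartesian_product finite_retract_classes assms)
  ultimately show ?thesis
    by (rule finite_subset)
qed

text \<open>Symmetry of the generating relation survives in the transitive closure; with
  transitivity it makes the images of related elements equal.\<close>

lemma grothendieck_cong_Image_eq:
  assumes "(x, y) \<in> grothendieck_cong C E"
  shows "grothendieck_cong C E `` {x} = grothendieck_cong C E `` {y}"
proof -
  have "sym (grothendieck_cong C E)"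
    unfolding grothendieck_cong_def by (rule sym_trancl) (auto simp: sym_def)
  moreover have "trans (grothendieck_cong C E)"
    unfolding grothendieck_cong_def by (rule trans_trancl)
  ultimately show ?thesis
    using assms unfolding sym_def trans_def by blast
qed

lemma profinitary_imp_cofinitary:
  assumes "profinitary C E"
  shows "cofinitary C E"
proof -
  interpret exact_category C E
    using assms unfolding profinitary_def by blast
  have hom_fin: "hom_finite C"
    and fiber: "\<And>\<gamma>. \<gamma> \<in> carrier (grothendieck_monoid C E) \<Longrightarrow> finite (Iso_fiber C E \<gamma>)"
    using assms unfolding profinitary_def by blast+
  have "finite {(iso_class C A, iso_class C B) | A B. A \<in> obj C \<and> B \<in> obj C \<and> x \<in> Ext C E A B}"
    (is "finite ?P") if x: "x \<in> Iso C" for x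
  proof -
    define \<gamma> where "\<gamma> = grothendieck_cong C E `` {x}"
    \<comment> \<open>\<open>D y\<close> collects the pairs whose direct sum has class
      \<open>y\<close>. Each is finite by the retract argument, and those with \<open>y\<close> in
      the fiber through \<open>x\<close> cover \<open>?P\<close>.\<close>
    define D where "D y = {(iso_class C A, iso_class C B) | A B. \<exists>T i j p q.
      is_biproduct C B A T i j p q \<and> iso_class C T = y}" for y
    have "\<gamma> \<in> carrier (grothendieck_monoid C E)"
      using x by (auto simp: \<gamma>_def grothendieck_monoid_def quotient_def)
    then have "finite (Iso_fiber C E \<gamma>)"
      by (rule fiber)
    moreover have "finite (D y)" if y: "y \<in> Iso_fiber C E \<gamma>" for y
    proof -
      obtain Y where Y: "Y \<in> obj C" "y = iso_class C Y"
        using y by (auto simp: Iso_fiber_def Iso_def)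
      have "finite (mor C Y Y)"
        using Y(1) hom_fin by (auto simp: hom_finite_def)
      then have "finite {(iso_class C A, iso_class C B) | A B. \<exists>T i j p q.
          is_biproduct C B A T i j p q \<and> isomorphic C T Y}"
        by (rule finite_decompositions)
      moreover have "D y \<subseteq> {(iso_class C A, iso_class C B) | A B. \<exists>T i j p q.
          is_biproduct C B A T i j p q \<and> isomorphic C T Y}"
        unfolding D_def using Y iso_class_eqD by blast
      ultimately show ?thesis
        using finite_subset by blast
    qed
    moreover have "?P \<subseteq> (\<Union>y \<in> Iso_fiber C E \<gamma>. D y)"
    proof
      fix c assume "c \<in> ?P"
      then obtain A B where AB: "c = (iso_class C A, iso_class C B)" "A \<in> obj C" "B \<in> obj C"
        "x \<in> Ext C E A B"
        by blast
      \<comment> \<open>The split sequence puts the class of \<open>T\<close> in the same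
        \<open>Ext C E A B\<close> as \<open>x\<close>, so a single generating step of the
        congruence relates the two.\<close>
      obtain T i j p q where bi: "is_biproduct C B A T i j p q"
        using ex_biproduct AB by blast
      then have T: "i \<in> mor C B T" "q \<in> mor C T A" "T \<in> obj C"
        using mor_obj unfolding is_biproduct_def by blast+
      then have "iso_class C T \<in> Ext C E A B"
        using split_exact[OF bi] unfolding Ext_def by blast
      then have "(x, iso_class C T) \<in> grothendieck_cong C E"
        using AB unfolding grothendieck_cong_def by (blast intro: r_into_trancl)
      then have "iso_class C T \<in> Iso_fiber C E \<gamma>"
        using T(3) grothendieck_cong_Image_eq[of x "iso_class C T" C E] by (simp add: Iso_fiber_def \<gamma>_def Iso_def)
      moreover have "c \<in> D (iso_class C T)"
        using AB(1) bi unfolding D_def by blast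
      ultimately show "c \<in> (\<Union>y \<in> Iso_fiber C E \<gamma>. D y)"
        by blast
    qed
    ultimately show ?thesis
      by (meson finite_UN_I finite_subset)
  qed
  then show ?thesis
    using hom_fin exact_category_axioms unfolding cofinitary_def by blast
qed

section \<open>The opposite exact category\<close>

text \<open>Opening the whole locale hierarchy at once turns exactness of a new category into one
  goal per axiom.\<close>

lemmas exact_category_introduction = exact_category.intro additive_category.intro
  preadditive_category.intro category.intro preadditive_category_axioms.intro
  additive_category_axioms.intro exact_category_axioms.intro

text \<open>Inflations and deflations trade places here, so one half of each dual pair of axioms
  suffices for a full subcategory. The arguments of \<open>mzero\<close> are swapped because it is
  indexed by source and target.\<close>

definition opposite :: "('o, 'm, 'x) preadd_cat_scheme \<Rightarrow> ('o, 'm) preadd_cat" where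
  "opposite C = \<lparr>obj = obj C, arr = arr C, src = tgt C, tgt = src C, ident = ident C,
    comp = (\<lambda>g f. f \<cdot>\<^bsub>C\<^esub> g), msum = msum C, mzero = (\<lambda>X Y. mzero C Y X)\<rparr>"

lemma opposite_sel [simp]:
  "obj (opposite C) = obj C" "arr (opposite C) = arr C"
  "src (opposite C) = tgt C" "tgt (opposite C) = src C"
  "ident (opposite C) = ident C" "g \<cdot>\<^bsub>opposite C\<^esub> f = f \<cdot>\<^bsub>C\<^esub> g"
  "msum (opposite C) = msum C" "mzero (opposite C) X Y = mzero C Y X"
  by (simp_all add: opposite_def)

lemma mor_opposite [simp]: "mor (opposite C) X Y = mor C Y X"
  by (auto simp: mor_def)

lemma iso_mor_opposite: "iso_mor (opposite C) X Y = iso_mor C Y X"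
  by (auto simp: iso_mor_def)

lemma is_kernel_opposite: "is_kernel (opposite C) p i \<longleftrightarrow> is_cokernel C p i"
  unfolding is_kernel_def is_cokernel_def mor_opposite opposite_sel
  by (intro iffI; elim exE conjE; intro exI conjI; assumption)

lemma is_cokernel_opposite: "is_cokernel (opposite C) i p \<longleftrightarrow> is_kernel C i p"
  unfolding is_kernel_def is_cokernel_def mor_opposite opposite_sel
  by (intro iffI; elim exE conjE; intro exI conjI; assumption)

lemma is_pushout_opposite: "is_pushout (opposite C) i f i' f' \<longleftrightarrow> is_pullback C i f i' f'"
  unfolding is_pushout_def is_pullback_def mor_opposite opposite_sel
  by (intro iffI; elim exE conjE; intro exI conjI; (assumption | rule sym, assumption))

lemma is_pullback_opposite: "is_pullback (opposite C) p f p' f' \<longleftrightarrow> is_pushout C p f p' f'"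
  unfolding is_pushout_def is_pullback_def mor_opposite opposite_sel
  by (intro iffI; elim exE conjE; intro exI conjI; (assumption | rule sym, assumption))

lemma is_biproduct_opposite:
  "is_biproduct (opposite C) X Y S i j p q \<longleftrightarrow> is_biproduct C X Y S p q i j"
  by (auto simp: is_biproduct_def)

lemma zero_object_opposite: "zero_object (opposite C) Z \<longleftrightarrow> zero_object C Z"
  by (auto simp: zero_object_def)

lemma inflation_converse: "inflation (E\<inverse>) i \<longleftrightarrow> deflation E i"
  by (simp add: inflation_def deflation_def)

lemma deflation_converse: "deflation (E\<inverse>) p \<longleftrightarrow> inflation E p"
  by (simp add: inflation_def deflation_def)

text \<open>Reversing a split sequence gives the inclusion of the other summand followed by the
  projection onto the first, so \<open>split_exact\<close> for the opposite category needs the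
  summands swapped. Only the identity for the sum is affected, and addition of morphisms
  commutes.\<close>

lemma (in preadditive_category) is_biproduct_commute:
  assumes "is_biproduct C X Y T i j p q"
  shows "is_biproduct C Y X T j i q p"
proof -
  have "i \<cdot> p \<in> mor C T T" "j \<cdot> q \<in> mor C T T" "T \<in> obj C"
    using assms comp_mor mor_obj unfolding is_biproduct_def by blast+
  moreover from this interpret comm_group "hom_group C T T"
    by (blast intro: hom_comm_group)
  have "(i \<cdot> p) \<boxplus> (j \<cdot> q) = (j \<cdot> q) \<boxplus> (i \<cdot> p)"
    using calculation m_comm[of "i \<cdot> p" "j \<cdot> q"] by (simp add: hom_group_def)
  then show ?thesis
    using assms unfolding is_biproduct_def by simp
qed

text \<open>An isomorphism of sequences in the opposite category runs, in \<open>C\<close>, from the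
  primed sequence to the unprimed one. \<open>iso_closed\<close> wants the other direction, so the
  commuting squares have to be inverted.\<close>

lemma (in category) iso_square_inverse:
  assumes "f \<in> mor C X Y" "g \<in> mor C X' Y'"
    and a: "a \<in> mor C X' X" "a' \<in> mor C X X'" "a \<cdot> a' = ident C X"
    and b: "b \<in> mor C Y' Y" "b' \<in> mor C Y Y'" "b' \<cdot> b = ident C Y'"
    and square: "f \<cdot> a = b \<cdot> g"
  shows "b' \<cdot> f = g \<cdot> a'"
proof -
  have "b' \<cdot> f = b' \<cdot> ((f \<cdot> a) \<cdot> a')"
    using cancel_right[OF a(2,1) assms(1) a(3)] by simp
  also have "\<dots> = (b' \<cdot> (b \<cdot> g)) \<cdot> a'"
    using assms unfolding square by (simp add: arr_simps)
  also have "\<dots> = g \<cdot> a'"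
    using cancel_left[OF assms(2) b] by simp
  finally show ?thesis .
qed

lemma (in exact_category) exact_category_opposite: "exact_category (opposite C) (E\<inverse>)"
proof (intro exact_category_introduction)
  fix f g h W X Y Z
  show "f \<in> arr (opposite C) \<Longrightarrow> src (opposite C) f \<in> obj (opposite C)"
    "f \<in> arr (opposite C) \<Longrightarrow> tgt (opposite C) f \<in> obj (opposite C)"
    by (simp_all add: src_obj tgt_obj)
  show "X \<in> obj (opposite C) \<Longrightarrow> ident (opposite C) X \<in> mor (opposite C) X X"
    by (simp add: ident_mor)
  show "f \<in> mor (opposite C) X Y \<Longrightarrow> g \<in> mor (opposite C) Y Z \<Longrightarrow>
      g \<cdot>\<^bsub>opposite C\<^esub> f \<in> mor (opposite C) X Z"
    by (auto intro: comp_mor)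
  show "f \<in> mor (opposite C) X Y \<Longrightarrow> f \<cdot>\<^bsub>opposite C\<^esub> ident (opposite C) X = f"
    "f \<in> mor (opposite C) X Y \<Longrightarrow> ident (opposite C) Y \<cdot>\<^bsub>opposite C\<^esub> f = f"
    by (auto intro: comp_ident ident_comp)
  show "f \<in> mor (opposite C) W X \<Longrightarrow> g \<in> mor (opposite C) X Y \<Longrightarrow> h \<in> mor (opposite C) Y Z \<Longrightarrow>
      (h \<cdot>\<^bsub>opposite C\<^esub> g) \<cdot>\<^bsub>opposite C\<^esub> f = h \<cdot>\<^bsub>opposite C\<^esub> (g \<cdot>\<^bsub>opposite C\<^esub> f)"
    using comp_assoc by auto
  have "hom_group (opposite C) X Y = hom_group C Y X"
    by (simp add: hom_group_def)
  then show "X \<in> obj (opposite C) \<Longrightarrow> Y \<in> obj (opposite C) \<Longrightarrow> comm_group (hom_group (opposite C) X Y)"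
    using hom_comm_group by simp
  show "f \<in> mor (opposite C) X Y \<Longrightarrow> g \<in> mor (opposite C) Y Z \<Longrightarrow> h \<in> mor (opposite C) Y Z \<Longrightarrow>
      (g \<boxplus>\<^bsub>opposite C\<^esub> h) \<cdot>\<^bsub>opposite C\<^esub> f =
      (g \<cdot>\<^bsub>opposite C\<^esub> f) \<boxplus>\<^bsub>opposite C\<^esub> (h \<cdot>\<^bsub>opposite C\<^esub> f)"
    using comp_sum_right by auto
  show "f \<in> mor (opposite C) X Y \<Longrightarrow> g \<in> mor (opposite C) X Y \<Longrightarrow> h \<in> mor (opposite C) Y Z \<Longrightarrow>
      h \<cdot>\<^bsub>opposite C\<^esub> (f \<boxplus>\<^bsub>opposite C\<^esub> g) =
      (h \<cdot>\<^bsub>opposite C\<^esub> f) \<boxplus>\<^bsub>opposite C\<^esub> (h \<cdot>\<^bsub>opposite C\<^esub> g)"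
    using comp_sum_left by auto
  show "\<exists>Z. zero_object (opposite C) Z"
    using ex_zero_object by (simp add: zero_object_opposite)
  show "X \<in> obj (opposite C) \<Longrightarrow> Y \<in> obj (opposite C) \<Longrightarrow>
      \<exists>S i j p q. is_biproduct (opposite C) X Y S i j p q"
    using ex_biproduct unfolding is_biproduct_opposite opposite_sel by blast
  show "E\<inverse> \<subseteq> kernel_cokernel_pairs (opposite C)"
    using kernel_cokernel
    by (auto simp: kernel_cokernel_pairs_def is_kernel_opposite is_cokernel_opposite)
  fix i j p q S
  show "is_biproduct (opposite C) X Z S i j p q \<Longrightarrow> (i, q) \<in> E\<inverse>"
    using split_exact is_biproduct_commute unfolding is_biproduct_opposite by blast
next
  fix i p X Y Z i' X' Y' p' Z' a b c
  assume ip: "(i, p) \<in> E\<inverse>" "i \<in> mor (opposite C) X Y" "p \<in> mor (opposite C) Y Z"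
      "i' \<in> mor (opposite C) X' Y'" "p' \<in> mor (opposite C) Y' Z'"
    and a: "a \<in> iso_mor (opposite C) X X'" and b: "b \<in> iso_mor (opposite C) Y Y'"
    and c: "c \<in> iso_mor (opposite C) Z Z'"
    and squares: "b \<cdot>\<^bsub>opposite C\<^esub> i = i' \<cdot>\<^bsub>opposite C\<^esub> a" "c \<cdot>\<^bsub>opposite C\<^esub> p = p' \<cdot>\<^bsub>opposite C\<^esub> b"
  obtain a' where a': "a \<in> mor C X' X" "a' \<in> mor C X X'" "a' \<cdot> a = ident C X'" "a \<cdot> a' = ident C X"
    using a unfolding iso_mor_opposite by (rule iso_morE)
  obtain b' where b': "b \<in> mor C Y' Y" "b' \<in> mor C Y Y'" "b' \<cdot> b = ident C Y'" "b \<cdot> b' = ident C Y"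
    using b unfolding iso_mor_opposite by (rule iso_morE)
  obtain c' where c': "c \<in> mor C Z' Z" "c' \<in> mor C Z Z'" "c' \<cdot> c = ident C Z'" "c \<cdot> c' = ident C Z"
    using c unfolding iso_mor_opposite by (rule iso_morE)
  note ip = ip[simplified]
  have "b' \<cdot> p = p' \<cdot> c'"
    using iso_square_inverse[OF ip(3,5) c'(1,2,4) b'(1,2,3)] squares by simp
  moreover have "a' \<cdot> i = i' \<cdot> b'"
    using iso_square_inverse[OF ip(2,4) b'(1,2,4) a'(1,2,3)] squares by simp
  moreover have "c' \<in> iso_mor C Z Z'" "b' \<in> iso_mor C Y Y'" "a' \<in> iso_mor C X X'"
    using a' b' c' iso_morI by metis+
  ultimately show "(i', p') \<in> E\<inverse>"
    using iso_closed[OF ip(1,3,2,5,4)] by simp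
next
  fix i i'
  show "inflation (E\<inverse>) i \<Longrightarrow> inflation (E\<inverse>) i' \<Longrightarrow> tgt (opposite C) i = src (opposite C) i' \<Longrightarrow>
      inflation (E\<inverse>) (i' \<cdot>\<^bsub>opposite C\<^esub> i)"
    using deflation_comp[of i' i] by (simp add: inflation_converse)
  show "deflation (E\<inverse>) i \<Longrightarrow> deflation (E\<inverse>) i' \<Longrightarrow> tgt (opposite C) i = src (opposite C) i' \<Longrightarrow>
      deflation (E\<inverse>) (i' \<cdot>\<^bsub>opposite C\<^esub> i)"
    using inflation_comp[of i' i] by (simp add: deflation_converse)
  fix f
  show "inflation (E\<inverse>) i \<Longrightarrow> f \<in> arr (opposite C) \<Longrightarrow> src (opposite C) f = src (opposite C) i \<Longrightarrow>
      \<exists>i' f'. is_pushout (opposite C) i f i' f' \<and> inflation (E\<inverse>) i'"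
    using deflation_pullback[of i f] by (simp add: inflation_converse is_pushout_opposite)
  show "deflation (E\<inverse>) i \<Longrightarrow> f \<in> arr (opposite C) \<Longrightarrow> tgt (opposite C) f = tgt (opposite C) i \<Longrightarrow>
      \<exists>i' f'. is_pullback (opposite C) i f i' f' \<and> deflation (E\<inverse>) i'"
    using inflation_pushout[of i f] by (simp add: deflation_converse is_pullback_opposite)
qed

section \<open>Full exact subcategories\<close>

lemma full_subcategory_sel [simp]:
  "obj (full_subcategory C S) = S"
  "arr (full_subcategory C S) = {f \<in> arr C. src C f \<in> S \<and> tgt C f \<in> S}"
  "src (full_subcategory C S) = src C" "tgt (full_subcategory C S) = tgt C"
  "ident (full_subcategory C S) = ident C" "g \<cdot>\<^bsub>full_subcategory C S\<^esub> f = g \<cdot>\<^bsub>C\<^esub> f"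
  "msum (full_subcategory C S) = msum C" "mzero (full_subcategory C S) = mzero C"
  by (simp_all add: full_subcategory_def)

lemma mor_full_subcategory [simp]:
  "mor (full_subcategory C S) X Y = (if X \<in> S \<and> Y \<in> S then mor C X Y else {})"
  by (auto simp: mor_def)

lemma iso_mor_full_subcategory:
  "iso_mor (full_subcategory C S) X Y = (if X \<in> S \<and> Y \<in> S then iso_mor C X Y else {})"
  by (auto simp: iso_mor_def)

lemma is_biproduct_full_subcategory:
  assumes "X \<in> S" "Y \<in> S"
  shows "is_biproduct (full_subcategory C S) X Y T i j p q \<longleftrightarrow> T \<in> S \<and> is_biproduct C X Y T i j p q"
  using assms by (auto simp: is_biproduct_def)

text \<open>By fullness the factorizing morphism already lies in the subcategory, and there are
  fewer test objects, so the universal property restricts. Cokernels and pushouts below restrict for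
  the same reason.\<close>

lemma is_kernel_full_subcategory:
  assumes "is_kernel C p i" "i \<in> mor C X Y" "p \<in> mor C Y Z" "X \<in> S" "Y \<in> S" "Z \<in> S"
  shows "is_kernel (full_subcategory C S) p i"
proof -
  let ?D = "full_subcategory C S"
  have typing: "i \<in> mor ?D X Y" "p \<in> mor ?D Y Z"
    using assms by simp_all
  note ker = assms(1)[unfolded is_kernel_iff[OF assms(2,3)]]
  have "\<exists>!g. g \<in> mor ?D W X \<and> i \<cdot>\<^bsub>C\<^esub> g = f" if "f \<in> mor ?D W Y" "p \<cdot>\<^bsub>C\<^esub> f = mzero C W Z" for W f
    using that ker assms(4) by (simp split: if_splits)
  then show ?thesis
    unfolding is_kernel_iff[OF typing] full_subcategory_sel using ker by blast
qed

lemma is_cokernel_full_subcategory: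
  assumes "is_cokernel C i p" "i \<in> mor C X Y" "p \<in> mor C Y Z" "X \<in> S" "Y \<in> S" "Z \<in> S"
  shows "is_cokernel (full_subcategory C S) i p"
proof -
  let ?D = "full_subcategory C S"
  have typing: "i \<in> mor ?D X Y" "p \<in> mor ?D Y Z"
    using assms by simp_all
  note coker = assms(1)[unfolded is_cokernel_iff[OF assms(2,3)]]
  have "\<exists>!g. g \<in> mor ?D Z W \<and> g \<cdot>\<^bsub>C\<^esub> p = f" if "f \<in> mor ?D Y W" "f \<cdot>\<^bsub>C\<^esub> i = mzero C X W" for W f
    using that coker assms(6) by (simp split: if_splits)
  then show ?thesis
    unfolding is_cokernel_iff[OF typing] full_subcategory_sel using coker by blast
qed

lemma is_pushout_full_subcategory:
  assumes "is_pushout C i f i' f'" "i \<in> mor C X Y" "f \<in> mor C X X'" "i' \<in> mor C X' P" "f' \<in> mor C Y P"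
    "X \<in> S" "Y \<in> S" "X' \<in> S" "P \<in> S"
  shows "is_pushout (full_subcategory C S) i f i' f'"
proof -
  let ?D = "full_subcategory C S"
  have typing: "i \<in> mor ?D X Y" "f \<in> mor ?D X X'" "i' \<in> mor ?D X' P" "f' \<in> mor ?D Y P"
    using assms by simp_all
  note po = assms(1)[unfolded is_pushout_iff[OF assms(2-5)]]
  have "\<exists>!w. w \<in> mor ?D P Q \<and> w \<cdot>\<^bsub>C\<^esub> f' = u \<and> w \<cdot>\<^bsub>C\<^esub> i' = v"
    if "u \<in> mor ?D Y Q" "v \<in> mor ?D X' Q" "u \<cdot>\<^bsub>C\<^esub> i = v \<cdot>\<^bsub>C\<^esub> f" for Q u v
    using that po assms(9) by (simp split: if_splits)
  then show ?thesis
    unfolding is_pushout_iff[OF typing] full_subcategory_sel using po by blast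
qed

lemma induced_exact_structure_iff:
  assumes "i \<in> mor C X Y" "p \<in> mor C Y Z"
  shows "(i, p) \<in> induced_exact_structure C E S \<longleftrightarrow> (i, p) \<in> E \<and> X \<in> S \<and> Y \<in> S \<and> Z \<in> S"
  using assms by (auto simp: induced_exact_structure_def mor_def)

lemma full_subcategory_opposite: "full_subcategory (opposite C) S = opposite (full_subcategory C S)"
  by (auto simp: full_subcategory_def opposite_def)

lemma induced_exact_structure_opposite:
  "induced_exact_structure (opposite C) (E\<inverse>) S = (induced_exact_structure C E S)\<inverse>"
  by (auto simp: induced_exact_structure_def)

section \<open>Exactness and cofinitarity of the induced structure\<close>

context exact_category
begin

lemma induced_typeE:
  assumes "(i, p) \<in> induced_exact_structure C E S"
  obtains X Y Z where "(i, p) \<in> E" "i \<in> mor C X Y" "p \<in> mor C Y Z" "is_kernel C p i" "is_cokernel C i p"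
    "X \<in> S" "Y \<in> S" "Z \<in> S"
proof -
  have "(i, p) \<in> E"
    using assms by (auto simp: induced_exact_structure_def)
  then obtain X Y Z where "i \<in> mor C X Y" "p \<in> mor C Y Z" "is_kernel C p i" "is_cokernel C i p"
    by (rule E_typeE)
  with assms show ?thesis
    using that induced_exact_structure_iff[of i C X Y p Z E S] by blast
qed

lemma E_iso_middle:
  assumes "(i, p) \<in> E" "i \<in> mor C X Y" "p \<in> mor C Y Z" "u \<in> iso_mor C Y Y'"
  shows "\<exists>v \<in> mor C Y' Y. (u \<cdot> i, p \<cdot> v) \<in> E"
proof -
  obtain v where uv: "u \<in> mor C Y Y'" "v \<in> mor C Y' Y" "v \<cdot> u = ident C Y" "u \<cdot> v = ident C Y'"
    using assms(4) by (rule iso_morE)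
  have "(u \<cdot> i, p \<cdot> v) \<in> E"
  proof (rule iso_closed[OF assms(1-3) _ _ ident_iso assms(4) ident_iso])
    show ui: "u \<cdot> i \<in> mor C X Y'" and pv: "p \<cdot> v \<in> mor C Y' Z"
      using assms uv comp_mor by blast+
    show "u \<cdot> i = u \<cdot> i \<cdot> ident C X"
      using comp_ident[OF ui] by simp
    show "ident C Z \<cdot> p = p \<cdot> v \<cdot> u"
      using cancel_right[OF uv(1,2) assms(3) uv(3)] ident_comp[OF assms(3)] by simp
    show "X \<in> obj C" "Z \<in> obj C"
      using assms mor_obj by blast+
  qed
  then show ?thesis
    using uv(2) by blast
qed

lemma E_iso_right:
  assumes "(i, p) \<in> E" "i \<in> mor C X Y" "p \<in> mor C Y Z" "u \<in> iso_mor C Z Z'"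
  shows "(i, u \<cdot> p) \<in> E"
proof (rule iso_closed[OF assms(1-3,2) _ ident_iso ident_iso assms(4)])
  show "u \<cdot> p \<in> mor C Y Z'"
    using assms comp_mor unfolding iso_mor_def by blast
  then show "u \<cdot> p = u \<cdot> p \<cdot> ident C Y"
    by (simp add: comp_ident)
  show "ident C Y \<cdot> i = i \<cdot> ident C X"
    using assms(2) by (simp add: comp_ident ident_comp)
  show "X \<in> obj C" "Y \<in> obj C"
    using assms mor_obj by blast+
qed

text \<open>An inflation comes with one deflation in \<open>E\<close>; uniqueness of cokernels and
  closure under isomorphism let any other cokernel take its place. This recovers a full sequence
  from the inflation returned by the pushout axiom.\<close>

lemma inflation_cokernel:
  assumes "inflation E i" "is_cokernel C i p"
  shows "(i, p) \<in> E"
proof -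
  obtain c where c: "(i, c) \<in> E"
    using assms(1) unfolding inflation_def by blast
  then obtain X Y W where ic: "i \<in> mor C X Y" "c \<in> mor C Y W" "is_cokernel C i c"
    by (rule E_typeE)
  obtain Z where p: "p \<in> mor C Y Z"
    using assms(2) ic(1) mor_typeD unfolding is_cokernel_def by metis
  obtain a where "a \<in> iso_mor C W Z" "a \<cdot> c = p"
    using is_cokernel_unique[OF ic(1,2) p ic(3) assms(2)] by blast
  then show ?thesis
    using E_iso_right[OF c ic(1,2)] by blast
qed

lemma inflation_pushout_typed:
  assumes "inflation E i" "i \<in> mor C X Y" "f \<in> mor C X X'"
  obtains i' f' P where "is_pushout C i f i' f'" "inflation E i'" "i' \<in> mor C X' P" "f' \<in> mor C Y P"
proof -
  have "\<exists>i' f'. is_pushout C i f i' f' \<and> inflation E i'"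
    using assms by (intro inflation_pushout) (auto simp: mor_def)
  then obtain i' f' where po: "is_pushout C i f i' f'" "inflation E i'"
    by blast
  obtain X1 Y1 X1' P where "i \<in> mor C X1 Y1" "f \<in> mor C X1 X1'" "i' \<in> mor C X1' P" "f' \<in> mor C Y1 P"
    using po(1) unfolding is_pushout_def by blast
  then show ?thesis
    using that po mor_typeD[OF assms(2)] mor_typeD[OF assms(3)] by blast
qed

lemma extension_iso:
  assumes "full_exact_subcategory C E S" "(i, p) \<in> E" "i \<in> mor C X Y" "p \<in> mor C Y Z" "X \<in> S" "Z \<in> S"
  obtains Y' u where "Y' \<in> S" "u \<in> iso_mor C Y Y'"
proof -
  have "src C i = X" "tgt C p = Z" "tgt C i = Y"
    using assms by (auto simp: mor_def)
  then have "\<exists>Y' \<in> S. isomorphic C Y Y'"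
    using assms unfolding full_exact_subcategory_def by blast
  then show ?thesis
    using that unfolding isomorphic_def by blast
qed

text \<open>The sequence from \<open>X'\<close> through \<open>P\<close> to \<open>Z\<close> makes
  \<open>P\<close> an extension of objects of \<open>S\<close>, hence isomorphic to some
  \<open>P'\<close> in \<open>S\<close>. Both the square and the sequence are carried along that
  isomorphism.\<close>

lemma full_exact_subcategory_inflation_pushout:
  assumes sub: "full_exact_subcategory C E S"
    and "inflation (induced_exact_structure C E S) i" "f \<in> arr (full_subcategory C S)" "src C f = src C i"
  shows "\<exists>i' f'. is_pushout (full_subcategory C S) i f i' f' \<and>
    inflation (induced_exact_structure C E S) i'"
proof -
  obtain p where "(i, p) \<in> induced_exact_structure C E S"
    using assms(2) unfolding inflation_def by blast
  then obtain X Y Z where ip: "(i, p) \<in> E" "i \<in> mor C X Y" "p \<in> mor C Y Z" "is_cokernel C i p"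
    "X \<in> S" "Y \<in> S" "Z \<in> S"
    by (rule induced_typeE)
  obtain X' where f: "f \<in> mor C X X'" "X' \<in> S"
    using assms(3,4) ip(2) by (auto simp: mor_def)
  have "inflation E i"
    using ip(1) unfolding inflation_def by blast
  then obtain i' f' P where po: "is_pushout C i f i' f'" "inflation E i'" "i' \<in> mor C X' P" "f' \<in> mor C Y P"
    using ip(2) f(1) by (rule inflation_pushout_typed)
  obtain w where w: "w \<in> mor C P Z" "is_cokernel C i' w"
    using is_pushout_cokernel[OF po(1) ip(4,2,3) f(1) po(3,4)] by blast
  have iw: "(i', w) \<in> E"
    using po(2) w(2) by (rule inflation_cokernel)
  obtain P' u where u: "P' \<in> S" "u \<in> iso_mor C P P'"
    using extension_iso[OF sub iw po(3) w(1) f(2) ip(7)] .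
  obtain v where v: "v \<in> mor C P' P" "(u \<cdot> i', w \<cdot> v) \<in> E"
    using E_iso_middle[OF iw po(3) w(1) u(2)] by blast
  have "u \<in> mor C P P'"
    using u(2) unfolding iso_mor_def by blast
  then have typing: "u \<cdot> i' \<in> mor C X' P'" "u \<cdot> f' \<in> mor C Y P'" "w \<cdot> v \<in> mor C P' Z"
    using po w v comp_mor by blast+
  have "is_pushout C i f (u \<cdot> i') (u \<cdot> f')"
    using is_pushout_iso[OF po(1) ip(2) f(1) po(3,4) u(2)] .
  then have "is_pushout (full_subcategory C S) i f (u \<cdot> i') (u \<cdot> f')"
    using is_pushout_full_subcategory[OF _ ip(2) f(1) typing(1,2) ip(5,6) f(2) u(1)] by blast
  moreover have "(u \<cdot> i', w \<cdot> v) \<in> induced_exact_structure C E S"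
    using v(2) f(2) u(1) ip(7) induced_exact_structure_iff[OF typing(1,3)] by blast
  ultimately show ?thesis
    unfolding inflation_def by blast
qed

text \<open>This is the third isomorphism theorem in disguise. The composite already runs between
  objects of \<open>S\<close>, so only its cokernel \<open>Q\<close> has to be moved to an object of
  \<open>S\<close>.\<close>

lemma full_exact_subcategory_inflation_comp:
  assumes sub: "full_exact_subcategory C E S"
    and "inflation (induced_exact_structure C E S) i" "inflation (induced_exact_structure C E S) i'"
    and "tgt C i = src C i'"
  shows "inflation (induced_exact_structure C E S) (i' \<cdot> i)"
proof -
  obtain p where "(i, p) \<in> induced_exact_structure C E S"
    using assms(2) unfolding inflation_def by blast
  then obtain X Y Z where ip: "(i, p) \<in> E" "i \<in> mor C X Y" "p \<in> mor C Y Z" "is_cokernel C i p"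
    "X \<in> S" "Y \<in> S" "Z \<in> S"
    by (rule induced_typeE)
  obtain p' where "(i', p') \<in> induced_exact_structure C E S"
    using assms(3) unfolding inflation_def by blast
  then obtain Y1 Y' Z' where ip'1: "(i', p') \<in> E" "i' \<in> mor C Y1 Y'" "p' \<in> mor C Y' Z'" "is_cokernel C i' p'"
    "Y1 \<in> S" "Y' \<in> S" "Z' \<in> S"
    by (rule induced_typeE)
  have "Y1 = Y"
    using assms(4) ip(2) ip'1(2) by (simp add: mor_def)
  note ip' = ip'1[unfolded this]
  have infl: "inflation E i" "inflation E i'"
    using ip(1) ip'(1) unfolding inflation_def by blast+
  \<comment> \<open>One pushout gives both descriptions of \<open>Q\<close>: as an extension of
    \<open>Z'\<close> by \<open>Z\<close>, and as the cokernel of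
    \<open>i' \<cdot> i\<close>.\<close>
  obtain i'' q Q where po: "is_pushout C i' p i'' q" "inflation E i''" "i'' \<in> mor C Z Q" "q \<in> mor C Y' Q"
    using infl(2) ip'(2) ip(3) by (rule inflation_pushout_typed)
  obtain w where w: "w \<in> mor C Q Z'" "is_cokernel C i'' w"
    using is_pushout_cokernel[OF po(1) ip'(4,2,3) ip(3) po(3,4)] by blast
  have iw: "(i'', w) \<in> E"
    using po(2) w(2) by (rule inflation_cokernel)
  obtain Q' u where u: "Q' \<in> S" "u \<in> iso_mor C Q Q'"
    using extension_iso[OF sub iw po(3) w(1) ip(7) ip'(7)] .
  have comp: "i' \<cdot> i \<in> mor C X Y'"
    using ip(2) ip'(2) by (rule comp_mor)
  have "is_cokernel C (i' \<cdot> i) q"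
    using is_pushout_cokernel_comp[OF po(1) ip(4,2,3) ip'(2) po(3,4)] .
  then have "(i' \<cdot> i, q) \<in> E"
    using inflation_cokernel inflation_comp[OF infl assms(4)] by blast
  then have "(i' \<cdot> i, u \<cdot> q) \<in> E"
    using E_iso_right[OF _ comp po(4) u(2)] by blast
  moreover have "u \<cdot> q \<in> mor C Y' Q'"
    using u(2) po(4) comp_mor unfolding iso_mor_def by blast
  ultimately have "(i' \<cdot> i, u \<cdot> q) \<in> induced_exact_structure C E S"
    using induced_exact_structure_iff[OF comp] ip(5) ip'(6) u(1) by blast
  then show ?thesis
    unfolding inflation_def by blast
qed

text \<open>Reversing a sequence exchanges its ends and keeps its middle term, so closure under
  extensions is self-dual up to the direction of the isomorphism.\<close>

lemma full_exact_subcategory_opposite: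
  assumes "full_exact_subcategory C E S"
  shows "full_exact_subcategory (opposite C) (E\<inverse>) S"
  unfolding full_exact_subcategory_def
proof (intro conjI allI impI)
  show "S \<subseteq> obj (opposite C)" "\<exists>Z \<in> S. zero_object (opposite C) Z"
    using assms unfolding full_exact_subcategory_def by (simp_all add: zero_object_opposite)
  fix p i
  assume pi: "(p, i) \<in> E\<inverse> \<and> src (opposite C) p \<in> S \<and> tgt (opposite C) i \<in> S"
  then have "(i, p) \<in> E"
    by simp
  then obtain X Y Z where ip: "i \<in> mor C X Y" "p \<in> mor C Y Z"
    by (rule E_typeE)
  have "X \<in> S" "Z \<in> S"
    using pi ip by (auto simp: mor_def)
  then obtain Y' u where "Y' \<in> S" "u \<in> iso_mor C Y Y'"
    using extension_iso[OF assms \<open>(i, p) \<in> E\<close> ip] by blast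
  then have "\<exists>Y' \<in> S. isomorphic C Y' Y"
    using isomorphic_sym unfolding isomorphic_def by blast
  then show "\<exists>Y' \<in> S. isomorphic (opposite C) (tgt (opposite C) p) Y'"
    using ip(2) by (simp add: isomorphic_def iso_mor_opposite mor_def)
qed

lemma full_exact_subcategory_exact:
  assumes sub: "full_exact_subcategory C E S"
  shows "exact_category (full_subcategory C S) (induced_exact_structure C E S)"
proof -
  let ?D = "full_subcategory C S" and ?E = "induced_exact_structure C E S"
  interpret op: exact_category "opposite C" "E\<inverse>"
    by (rule exact_category_opposite)
  note sub_op = full_exact_subcategory_opposite[OF sub]
  have S: "X \<in> S \<Longrightarrow> X \<in> obj C" for X
    using sub unfolding full_exact_subcategory_def by blast
  show ?thesis
  proof (intro exact_category_introduction)
    fix f g h W X Y Z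
    show "f \<in> arr ?D \<Longrightarrow> src ?D f \<in> obj ?D" "f \<in> arr ?D \<Longrightarrow> tgt ?D f \<in> obj ?D"
      by simp_all
    show "X \<in> obj ?D \<Longrightarrow> ident ?D X \<in> mor ?D X X"
      by (simp add: S ident_mor)
    show "f \<in> mor ?D X Y \<Longrightarrow> g \<in> mor ?D Y Z \<Longrightarrow> g \<cdot>\<^bsub>?D\<^esub> f \<in> mor ?D X Z"
      by (auto intro: comp_mor split: if_splits)
    show "f \<in> mor ?D X Y \<Longrightarrow> f \<cdot>\<^bsub>?D\<^esub> ident ?D X = f" "f \<in> mor ?D X Y \<Longrightarrow> ident ?D Y \<cdot>\<^bsub>?D\<^esub> f = f"
      by (auto intro: comp_ident ident_comp split: if_splits)
    show "f \<in> mor ?D W X \<Longrightarrow> g \<in> mor ?D X Y \<Longrightarrow> h \<in> mor ?D Y Z \<Longrightarrow>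
        (h \<cdot>\<^bsub>?D\<^esub> g) \<cdot>\<^bsub>?D\<^esub> f = h \<cdot>\<^bsub>?D\<^esub> (g \<cdot>\<^bsub>?D\<^esub> f)"
      by (auto intro: comp_assoc split: if_splits)
    have "hom_group ?D X Y = hom_group C X Y" if "X \<in> S" "Y \<in> S"
      using that by (simp add: hom_group_def)
    then show "X \<in> obj ?D \<Longrightarrow> Y \<in> obj ?D \<Longrightarrow> comm_group (hom_group ?D X Y)"
      using hom_comm_group S by simp
    show "f \<in> mor ?D X Y \<Longrightarrow> g \<in> mor ?D Y Z \<Longrightarrow> h \<in> mor ?D Y Z \<Longrightarrow>
        (g \<boxplus>\<^bsub>?D\<^esub> h) \<cdot>\<^bsub>?D\<^esub> f = (g \<cdot>\<^bsub>?D\<^esub> f) \<boxplus>\<^bsub>?D\<^esub> (h \<cdot>\<^bsub>?D\<^esub> f)"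
      by (auto intro: comp_sum_left split: if_splits)
    show "f \<in> mor ?D X Y \<Longrightarrow> g \<in> mor ?D X Y \<Longrightarrow> h \<in> mor ?D Y Z \<Longrightarrow>
        h \<cdot>\<^bsub>?D\<^esub> (f \<boxplus>\<^bsub>?D\<^esub> g) = (h \<cdot>\<^bsub>?D\<^esub> f) \<boxplus>\<^bsub>?D\<^esub> (h \<cdot>\<^bsub>?D\<^esub> g)"
      by (auto intro: comp_sum_right split: if_splits)
  next
    obtain Z where "Z \<in> S" "zero_object C Z"
      using sub unfolding full_exact_subcategory_def by blast
    then have "zero_object ?D Z"
      using S by (simp add: zero_object_def)
    then show "\<exists>Z. zero_object ?D Z"
      by blast
  next
    fix X Y
    assume "X \<in> obj ?D" "Y \<in> obj ?D"
    then have XY: "X \<in> S" "Y \<in> S"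
      by simp_all
    then obtain T i j p q where bi: "is_biproduct C X Y T i j p q"
      using ex_biproduct S by blast
    then have "i \<in> mor C X T" "q \<in> mor C T Y"
      unfolding is_biproduct_def by blast+
    \<comment> \<open>A biproduct is a split extension, so closure under extensions supplies an
      isomorphic object in \<open>S\<close>, to which the biproduct is transported.\<close>
    then obtain T' u where "T' \<in> S" "u \<in> iso_mor C T T'"
      using extension_iso[OF sub split_exact[OF bi]] XY by blast
    then show "\<exists>T i j p q. is_biproduct ?D X Y T i j p q"
      unfolding is_biproduct_full_subcategory[OF XY] by (metis is_biproduct_iso[OF bi] iso_morE)
  next
    show "?E \<subseteq> kernel_cokernel_pairs ?D"
    proof (rule subrelI)
      fix i p assume "(i, p) \<in> ?E"
      then obtain X Y Z where typing: "i \<in> mor C X Y" "p \<in> mor C Y Z"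
        and ker: "is_kernel C p i" "is_cokernel C i p" and obj: "X \<in> S" "Y \<in> S" "Z \<in> S"
        by (rule induced_typeE)
      then show "(i, p) \<in> kernel_cokernel_pairs ?D"
        using is_kernel_full_subcategory[OF ker(1) typing obj] is_cokernel_full_subcategory[OF ker(2) typing obj]
        unfolding kernel_cokernel_pairs_def by blast
    qed
  next
    fix X Z T i j p q
    assume bi: "is_biproduct ?D X Z T i j p q"
    then have "i \<in> mor ?D X T" "q \<in> mor ?D T Z"
      unfolding is_biproduct_def by blast+
    then have typing: "i \<in> mor C X T" "q \<in> mor C T Z" "X \<in> S" "T \<in> S" "Z \<in> S"
      by (auto split: if_splits)
    then have "is_biproduct C X Z T i j p q"
      using bi unfolding is_biproduct_full_subcategory[OF typing(3,5)] by blast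
    then show "(i, q) \<in> ?E"
      using split_exact typing(3-5) unfolding induced_exact_structure_iff[OF typing(1,2)] by blast
  next
    fix i p X Y Z i' X' Y' p' Z' a b c
    assume ip: "(i, p) \<in> ?E" "i \<in> mor ?D X Y" "p \<in> mor ?D Y Z" "i' \<in> mor ?D X' Y'" "p' \<in> mor ?D Y' Z'"
      and abc: "a \<in> iso_mor ?D X X'" "b \<in> iso_mor ?D Y Y'" "c \<in> iso_mor ?D Z Z'"
      and squares: "b \<cdot>\<^bsub>?D\<^esub> i = i' \<cdot>\<^bsub>?D\<^esub> a" "c \<cdot>\<^bsub>?D\<^esub> p = p' \<cdot>\<^bsub>?D\<^esub> b"
    have typing: "i \<in> mor C X Y" "p \<in> mor C Y Z" "i' \<in> mor C X' Y'" "p' \<in> mor C Y' Z'"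
      and obj: "X' \<in> S" "Y' \<in> S" "Z' \<in> S"
      using ip(2-5) by (auto split: if_splits)
    have iso: "a \<in> iso_mor C X X'" "b \<in> iso_mor C Y Y'" "c \<in> iso_mor C Z Z'"
      using abc by (auto simp: iso_mor_full_subcategory split: if_splits)
    have "(i, p) \<in> E"
      using ip(1) by (auto simp: induced_exact_structure_def)
    then have "(i', p') \<in> E"
      using iso_closed[OF _ typing iso] squares by simp
    then show "(i', p') \<in> ?E"
      using induced_exact_structure_iff[OF typing(3,4)] obj by blast
  next
    fix i i'
    assume "inflation ?E i" "inflation ?E i'" "tgt ?D i = src ?D i'"
    then show "inflation ?E (i' \<cdot>\<^bsub>?D\<^esub> i)"
      using full_exact_subcategory_inflation_comp[OF sub] by simp
  next
    fix p p'
    assume "deflation ?E p" "deflation ?E p'" "tgt ?D p = src ?D p'"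
    then show "deflation ?E (p' \<cdot>\<^bsub>?D\<^esub> p)"
      \<comment> \<open>Composition is reversed in the opposite category, so there \<open>p'\<close>
        is the first inflation and \<open>p\<close> the second.\<close>
      using op.full_exact_subcategory_inflation_comp[OF sub_op, of p' p]
      by (simp add: induced_exact_structure_opposite inflation_converse)
  next
    fix i f
    assume "inflation ?E i" "f \<in> arr ?D" "src ?D f = src ?D i"
    then show "\<exists>i' f'. is_pushout ?D i f i' f' \<and> inflation ?E i'"
      using full_exact_subcategory_inflation_pushout[OF sub] by simp
  next
    fix p f
    assume "deflation ?E p" "f \<in> arr ?D" "tgt ?D f = tgt ?D p"
    then show "\<exists>p' f'. is_pullback ?D p f p' f' \<and> deflation ?E p'"
      using op.full_exact_subcategory_inflation_pushout[OF sub_op, of p f]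
      by (simp add: induced_exact_structure_opposite inflation_converse
          full_subcategory_opposite is_pushout_opposite)
  qed
qed

text \<open>By fullness an isomorphism class of the subcategory is the trace on \<open>S\<close> of
  an ambient class. Intersecting with \<open>S\<close> therefore sends the finite set of ambient
  pairs onto a set containing all pairs of the subcategory.\<close>

lemma cofinitary_full_exact_subcategory:
  assumes cofin: "cofinitary C E" and sub: "full_exact_subcategory C E S"
  shows "cofinitary (full_subcategory C S) (induced_exact_structure C E S)"
proof -
  let ?D = "full_subcategory C S" and ?E = "induced_exact_structure C E S"
  have S: "X \<in> S \<Longrightarrow> X \<in> obj C" for X
    using sub unfolding full_exact_subcategory_def by blast
  have class_eq: "iso_class ?D X = iso_class C X \<inter> S" if "X \<in> S" for X
    using that S by (auto simp: iso_class_def isomorphic_def iso_mor_full_subcategory)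
  have "finite {(iso_class ?D A, iso_class ?D B) | A B. A \<in> obj ?D \<and> B \<in> obj ?D \<and> x \<in> Ext ?D ?E A B}"
    (is "finite ?P") if x: "x \<in> Iso ?D" for x
  proof -
    obtain X where X: "X \<in> S" "x = iso_class ?D X"
      using x by (auto simp: Iso_def)
    let ?Q = "{(iso_class C A, iso_class C B) | A B. A \<in> obj C \<and> B \<in> obj C \<and> iso_class C X \<in> Ext C E A B}"
    have "finite ?Q"
      using cofin X S unfolding cofinitary_def Iso_def by blast
    moreover have "?P \<subseteq> (\<lambda>(a, b). (a \<inter> S, b \<inter> S)) ` ?Q"
    proof
      fix c assume "c \<in> ?P"
      then obtain A B where AB: "c = (iso_class ?D A, iso_class ?D B)" "A \<in> S" "B \<in> S"
        "x \<in> Ext ?D ?E A B"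
        by auto
      obtain Y i p where Y: "x = iso_class ?D Y" "Y \<in> S" "(i, p) \<in> ?E" "i \<in> mor C B Y" "p \<in> mor C Y A"
        using AB(2-4) by (auto simp: Ext_def split: if_splits)
      \<comment> \<open>\<open>x\<close> is presented by \<open>X\<close> while the sequence has
        middle term \<open>Y\<close>; equality of their classes in the subcategory has to yield an
        ambient isomorphism.\<close>
      have "Y \<in> iso_class ?D Y"
        using class_eq[OF Y(2)] Y(2) S[OF Y(2)] isomorphic_refl by (auto simp: iso_class_def)
      then have "Y \<in> iso_class C X"
        using class_eq[OF X(1)] X(2) Y(1) by simp
      then have "iso_class C X = iso_class C Y"
        by (intro iso_class_eqI) (simp add: iso_class_def)
      moreover have "(i, p) \<in> E"
        using Y(3) by (auto simp: induced_exact_structure_def)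
      ultimately have "iso_class C X \<in> Ext C E A B"
        using Y S unfolding Ext_def by blast
      then have "(iso_class C A, iso_class C B) \<in> ?Q"
        using AB S by blast
      then show "c \<in> (\<lambda>(a, b). (a \<inter> S, b \<inter> S)) ` ?Q"
        using AB class_eq by (intro image_eqI) auto
    qed
    ultimately show ?thesis
      using finite_surj by blast
  qed
  moreover have "hom_finite ?D"
    using cofin S unfolding cofinitary_def hom_finite_def by simp
  ultimately show ?thesis
    using full_exact_subcategory_exact[OF sub] unfolding cofinitary_def by blast
qed

end

theorem corollary1p5:
  shows "(\<forall>(A :: ('o, 'm) preadd_cat) S.
            abelian_category A \<and> profinitary A (kernel_cokernel_pairs A) \<and>
            full_exact_subcategory A (kernel_cokernel_pairs A) S \<longrightarrow>
            cofinitary (full_subcategory A S)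
              (induced_exact_structure A (kernel_cokernel_pairs A) S)) \<and>
         (\<forall>(A :: ('p, 'n) preadd_cat) E.
            profinitary A E \<and> finitely_generated_monoid (grothendieck_monoid A E) \<longrightarrow>
            cofinitary A E)"
proof (intro conjI allI impI; elim conjE)
  fix A :: "('o, 'm) preadd_cat" and S
  assume "profinitary A (kernel_cokernel_pairs A)" and
    sub: "full_exact_subcategory A (kernel_cokernel_pairs A) S"
  then have cofin: "cofinitary A (kernel_cokernel_pairs A)"
    by (intro profinitary_imp_cofinitary)
  then interpret exact_category A "kernel_cokernel_pairs A"
    unfolding cofinitary_def by blast
  show "cofinitary (full_subcategory A S) (induced_exact_structure A (kernel_cokernel_pairs A) S)"
    using cofin sub by (rule cofinitary_full_exact_subcategory)
next
  fix A :: "('p, 'n) preadd_cat" and E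
  assume "profinitary A E"
  then show "cofinitary A E"
    by (rule profinitary_imp_cofinitary)
qed

end
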